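(* Consider the perturbed Super-Kagome lattice with fixed vertex weight $\mu>0$ and monomeric edge weights given by $\alpha,\beta>0$ with $2\alpha+\beta=\mu$, i.e. $\gamma_1=\dots=\gamma_6=\alpha$ and $\gamma_7=\gamma_8=\gamma_9=\beta$, and with Laplacian $(\Delta_\gamma f)(v)=f(v)-\frac1\mu\sum_{w\sim v}\gamma_{vw}f(w)$ on $\ell^2(V)$. Then the spectrum of $\Delta_\gamma$ is given by $$\sigma(\Delta_\gamma)=\left[0,\ \left(1-\frac{\alpha}{2\mu}\right)-\frac{|3\alpha-2\beta|}{2\mu}\right]\ \cup\ \left[\left(1-\frac{\alpha}{2\mu}\right)+\frac{|3\alpha-2\beta|}{2\mu},\ 2-\frac{\alpha}{\mu}\right],$$ with flat bands at $\frac{3\alpha}{\mu}$ and $2-\frac{\alpha}{\mu}$.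
   Context: The Super-Kagome lattice is the Archimedean tiling $(3.12^2)$, in which every vertex is surrounded by one triangle and two dodecagons. As a graph with periodic edge weights it is described as follows. The vertex set is $V=\{v_j+\beta : j\in\{1,\dots,6\},\ \beta\in\mathbb{Z}^2\}$ (disjoint translates of six vertices), with translations $T_{\beta'}(v_j+\beta)=v_j+\beta+\beta'$; write $\omega_1=(1,0)$, $\omega_2=(0,1)$. The edges are the $\mathbb{Z}^2$-translates of the following nine edges, with the weights indicated (symmetric and constant along translates): $v_5\sim v_6$ ($\gamma_1$), $v_4\sim v_6$ ($\gamma_2$), $v_4\sim v_5$ ($\gamma_3$), $v_1\sim v_2$ ($\gamma_4$), $v_2\sim v_3$ ($\gamma_5$), $v_1\sim v_3$ ($\gamma_6$), $v_3\sim v_4$ ($\gamma_7$), $v_2\sim v_6+\omega_1$ ($\gamma_8$), $v_1\sim v_5+\omega_2$ ($\gamma_9$). Weights $\gamma_1,\dots,\gamma_6$ are on edges of triangles; $\gamma_7,\gamma_8,\gamma_9$ are on edges separating two dodecagons. Flat bands: for $\theta\in\mathbb{R}^2$ let $\ell^2(V)_\theta=\{f:V\to\mathbb{C}: f(T_\beta v)=e^{i\langle\theta,\beta\rangle}f(v)\ \text{for all } v\in V,\ \beta\in\mathbb{Z}^2\}$ (6-dimensional) and let $\Delta_\gamma^\theta$ be the operator on $\ell^2(V)_\theta$ given by the same formula as $\Delta_\gamma$. $\Delta_\gamma$ has a flat band at energy $E\in\mathbb{R}$ if $E\in\sigma(\Delta_\gamma^\theta)$ for all $\theta$ (equivalently,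 there is an infinite orthonormal family of eigenfunctions of $\Delta_\gamma$ in $\ell^2(V)$ to the eigenvalue $E$). *)

theory Defs
  imports "HOL-Analysis.Analysis"
begin

datatype site = V1 | V2 | V3 | V4 | V5 | V6

lemma UNIV_site: "(UNIV :: site set) = {V1, V2, V3, V4, V5, V6}"
  using site.exhaust by blast

instance site :: finite
  by standard (simp add: UNIV_site)

text \<open>The pair \<open>(j, b)\<close> stands for the vertex \<open>j + b\<close>.\<close>

type_synonym vertex = "site \<times> int \<times> int"

definition translate :: "int \<times> int \<Rightarrow> vertex \<Rightarrow> vertex" where
  "translate b v = (fst v, snd v + b)"

text \<open>\<open>bond k v w\<close>: the vertices \<open>v\<close> and \<open>w\<close> are joined by an edge of the \<open>k\<close>-th
  translation class, which carries the weight \<open>\<gamma> k\<close>. Classes 1--6 are the sides of the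
  triangles, classes 7--9 separate two dodecagons.\<close>

inductive bond :: "nat \<Rightarrow> vertex \<Rightarrow> vertex \<Rightarrow> bool" where
  "bond 1 (V5, b) (V6, b)"
| "bond 2 (V4, b) (V6, b)"
| "bond 3 (V4, b) (V5, b)"
| "bond 4 (V1, b) (V2, b)"
| "bond 5 (V2, b) (V3, b)"
| "bond 6 (V1, b) (V3, b)"
| "bond 7 (V3, b) (V4, b)"
| "bond 8 (V2, b) (V6, b + (1, 0))"
| "bond 9 (V1, b) (V5, b + (0, 1))"
| bond_sym: "bond k v w \<Longrightarrow> bond k w v"

definition adj :: "vertex \<Rightarrow> vertex \<Rightarrow> bool" where
  "adj v w \<longleftrightarrow> (\<exists>k. bond k v w)"

text \<open>Two adjacent vertices are joined by a bond of exactly one class, so the sum below has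
  at most one nonzero term.\<close>

definition weight :: "(nat \<Rightarrow> real) \<Rightarrow> vertex \<Rightarrow> vertex \<Rightarrow> real" where
  "weight \<gamma> v w = (\<Sum>k | k \<in> {1..9} \<and> bond k v w. \<gamma> k)"

definition laplacian ::
    "real \<Rightarrow> (nat \<Rightarrow> real) \<Rightarrow> (vertex \<Rightarrow> complex) \<Rightarrow> vertex \<Rightarrow> complex" where
  "laplacian \<mu> \<gamma> f v =
     f v - complex_of_real (1 / \<mu>) * (\<Sum>w | adj v w. complex_of_real (weight \<gamma> v w) * f w)"

text \<open>Spectrum of a linear operator \<open>T\<close> on a complex vector space \<open>X\<close> of functions with
  norm \<open>N\<close>: the complement of the set of those \<open>z\<close> for which \<open>T - z\<close> is a
  bijection of \<open>X\<close> with bounded inverse.\<close>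

definition resolvent_set ::
    "('a \<Rightarrow> complex) set \<Rightarrow> (('a \<Rightarrow> complex) \<Rightarrow> real) \<Rightarrow>
     (('a \<Rightarrow> complex) \<Rightarrow> 'a \<Rightarrow> complex) \<Rightarrow> complex set" where
  "resolvent_set X N T =
     {z. let S = (\<lambda>f v. T f v - z * f v) in
           bij_betw S X X \<and> (\<exists>C. \<forall>g\<in>X. N (inv_into X S g) \<le> C * N g)}"

definition op_spectrum ::
    "('a \<Rightarrow> complex) set \<Rightarrow> (('a \<Rightarrow> complex) \<Rightarrow> real) \<Rightarrow>
     (('a \<Rightarrow> complex) \<Rightarrow> 'a \<Rightarrow> complex) \<Rightarrow> complex set" where
  "op_spectrum X N T = - resolvent_set X N T"

definition ell2 :: "('a \<Rightarrow> complex) set" where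
  "ell2 = {f. (\<lambda>v. (cmod (f v))\<^sup>2) summable_on UNIV}"

definition ell2_norm :: "('a \<Rightarrow> complex) \<Rightarrow> real" where
  "ell2_norm f = sqrt (\<Sum>\<^sub>\<infinity>v. (cmod (f v))\<^sup>2)"

definition fibre :: "real \<times> real \<Rightarrow> (vertex \<Rightarrow> complex) set" where
  "fibre \<theta> = {f. \<forall>v b. f (translate b v) =
     exp (\<i> * complex_of_real (\<theta> \<bullet> (real_of_int (fst b), real_of_int (snd b)))) * f v}"

text \<open>A quasi-periodic function is determined by its values on one period cell.\<close>

definition fibre_norm :: "(vertex \<Rightarrow> complex) \<Rightarrow> real" where
  "fibre_norm f = sqrt (\<Sum>j\<in>UNIV. (cmod (f (j, 0)))\<^sup>2)"

definition flat_band_at :: "real \<Rightarrow> (nat \<Rightarrow> real) \<Rightarrow> real \<Rightarrow> bool" where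
  "flat_band_at \<mu> \<gamma> E \<longleftrightarrow>
     (\<forall>\<theta>. complex_of_real E \<in> op_spectrum (fibre \<theta>) fibre_norm (laplacian \<mu> \<gamma>))"

end

theory Submission
  imports Defs
begin

text \<open>Let \<open>P\<close> (\<open>avg\<close>) be the projection onto functions constant on triangles and \<open>S\<close> (\<open>flip\<close>)
  the involution along the edges between dodecagons. Up to an affine change of the spectral parameter the Laplacian is
  \<open>B = p P + q S\<close> (\<open>hop\<close>) with \<open>p = 3 \<alpha>\<close>, \<open>q = \<beta>\<close>. The operator (\<open>core\<close>)
  \<open>W = P S + S P - S = P S P - (1 - P) S (1 - P)\<close>
  commutes with \<open>P\<close> and \<open>S\<close>, and \<open>(l - B) (l - p + B) = p q (w - W)\<close> for
  \<open>w = (l\<^sup>2 - p l - q\<^sup>2) / (p q)\<close>. For complex \<open>x\<close>, \<open>y\<close> the block form gives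
  \<open>\<parallel>x + y W\<parallel> \<le> max \<bar>x + y\<bar> \<bar>x - y\<bar>\<close>. If \<open>w \<notin> [-1, 1]\<close>, then \<open>0\<close> is not on the segment from
  \<open>w - 1\<close> to \<open>w + 1\<close>, so some \<open>\<tau>\<close> makes \<open>1 - \<tau> (w - W)\<close> a strict contraction, and \<open>l - B\<close> is
  inverted by a Neumann series. If \<open>w \<in> [-1, 1]\<close>, there is a Bloch eigenfunction; multiplied by
  \<open>r\<^bsup>\<bar>b\<^sub>1\<bar> + \<bar>b\<^sub>2\<bar>\<^esup>\<close> with \<open>r\<close> close to \<open>1\<close> it becomes an approximate eigenfunction in \<open>\<ell>\<^sup>2\<close>,
  because the cutoff changes by a small relative amount along each edge.\<close>

subsection \<open>Square-summable functions\<close>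

lemma ell2_norm_nonneg [simp]: "0 \<le> ell2_norm f"
  by (simp add: ell2_norm_def infsum_nonneg)

lemma ell2_norm_square: "(ell2_norm f)\<^sup>2 = (\<Sum>\<^sub>\<infinity>v. (cmod (f v))\<^sup>2)"
  by (simp add: ell2_norm_def infsum_nonneg)

text \<open>Membership and norm bound are both tested on finite sets, where the inequalities for
  \<open>L2_set\<close> apply and pointwise limits are harmless.\<close>

lemma ell2_leI:
  assumes "\<And>F. finite F \<Longrightarrow> L2_set (\<lambda>v. cmod (f v)) F \<le> c"
  shows "f \<in> ell2" "ell2_norm f \<le> c"
proof -
  have c: "0 \<le> c" using assms[of "{}"] by simp
  have fin: "(\<Sum>v\<in>F. (cmod (f v))\<^sup>2) \<le> c\<^sup>2" if "finite F" for F
    using assms[OF that] c unfolding L2_set_def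
    by (metis real_sqrt_le_iff real_sqrt_unique)
  have s: "(\<lambda>v. (cmod (f v))\<^sup>2) summable_on UNIV"
    by (rule nonneg_bdd_above_summable_on) (use fin in \<open>auto intro!: bdd_aboveI2[where M="c\<^sup>2"]\<close>)
  then show "f \<in> ell2" by (simp add: ell2_def)
  have "(\<Sum>\<^sub>\<infinity>v. (cmod (f v))\<^sup>2) \<le> c\<^sup>2"
    by (rule infsum_le_finite_sums[OF s]) (use fin in auto)
  then show "ell2_norm f \<le> c"
    using c unfolding ell2_norm_def by (simp add: real_le_lsqrt)
qed

lemma L2_set_le_ell2_norm:
  assumes "f \<in> ell2" "finite F"
  shows "L2_set (\<lambda>v. cmod (f v)) F \<le> ell2_norm f"
  unfolding L2_set_def ell2_norm_def
  using assms by (intro real_sqrt_le_mono finite_sum_le_infsum) (auto simp: ell2_def)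

lemma norm_le_ell2_norm: "f \<in> ell2 \<Longrightarrow> cmod (f v) \<le> ell2_norm f"
  using L2_set_le_ell2_norm[of f "{v}"] by simp

lemma ell2_add:
  assumes "f \<in> ell2" "g \<in> ell2"
  shows "(\<lambda>v. f v + g v) \<in> ell2" "ell2_norm (\<lambda>v. f v + g v) \<le> ell2_norm f + ell2_norm g"
proof -
  have "L2_set (\<lambda>v. cmod (f v + g v)) F \<le> ell2_norm f + ell2_norm g" if "finite F" for F
  proof -
    have "L2_set (\<lambda>v. cmod (f v + g v)) F \<le> L2_set (\<lambda>v. cmod (f v) + cmod (g v)) F"
      by (intro L2_set_mono norm_triangle_ineq) auto
    also have "\<dots> \<le> L2_set (\<lambda>v. cmod (f v)) F + L2_set (\<lambda>v. cmod (g v)) F"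
      by (rule L2_set_triangle_ineq)
    also have "\<dots> \<le> ell2_norm f + ell2_norm g"
      by (intro add_mono L2_set_le_ell2_norm assms that)
    finally show ?thesis .
  qed
  from ell2_leI[OF this]
  show "(\<lambda>v. f v + g v) \<in> ell2" "ell2_norm (\<lambda>v. f v + g v) \<le> ell2_norm f + ell2_norm g"
    by auto
qed

lemma ell2_scale:
  assumes "f \<in> ell2"
  shows "(\<lambda>v. c * f v) \<in> ell2" "ell2_norm (\<lambda>v. c * f v) = cmod c * ell2_norm f"
proof -
  show "(\<lambda>v. c * f v) \<in> ell2"
    using assms by (simp add: ell2_def norm_mult power_mult_distrib summable_on_cmult_right)
  show "ell2_norm (\<lambda>v. c * f v) = cmod c * ell2_norm f"
    by (simp add: ell2_norm_def norm_mult power_mult_distrib infsum_cmult_right' real_sqrt_mult)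
qed

lemma ell2_diff:
  assumes "f \<in> ell2" "g \<in> ell2"
  shows "(\<lambda>v. f v - g v) \<in> ell2"
  using ell2_add(1)[OF assms(1) ell2_scale(1)[OF assms(2), of "-1"]] by simp

lemma ell2_norm_zero [simp]: "(\<lambda>v. 0) \<in> ell2" "ell2_norm (\<lambda>v. 0) = 0"
  by (simp_all add: ell2_def ell2_norm_def)

lemma ell2_permute:
  assumes "bij \<sigma>" "f \<in> ell2"
  shows "(\<lambda>v. f (\<sigma> v)) \<in> ell2" "ell2_norm (\<lambda>v. f (\<sigma> v)) = ell2_norm f"
proof -
  show "(\<lambda>v. f (\<sigma> v)) \<in> ell2"
    using assms summable_on_reindex_bij_betw[of \<sigma> UNIV UNIV "\<lambda>v. (cmod (f v))\<^sup>2"]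
    by (simp add: ell2_def)
  show "ell2_norm (\<lambda>v. f (\<sigma> v)) = ell2_norm f"
    using assms infsum_reindex_bij_betw[of \<sigma> UNIV UNIV "\<lambda>v. (cmod (f v))\<^sup>2"]
    by (simp add: ell2_norm_def)
qed

text \<open>Reindexing by the bijections \<open>\<sigma> ^^ i\<close> turns the sum of the orbit
  totals into \<open>n\<close> times the original sum. Thus an inequality that holds only after
  adding up over a triangle or over a \<open>flip\<close> pair still compares the full sums.\<close>

lemma infsum_orbit_mono:
  fixes \<sigma> :: "'a \<Rightarrow> 'a" and \<phi> \<psi> :: "'a \<Rightarrow> real"
  assumes "bij \<sigma>" "0 < n" "\<phi> summable_on UNIV" "\<psi> summable_on UNIV"
    and "\<And>v. (\<Sum>i<n. \<phi> ((\<sigma> ^^ i) v)) \<le> (\<Sum>i<n. \<psi> ((\<sigma> ^^ i) v))"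
  shows "infsum \<phi> UNIV \<le> infsum \<psi> UNIV"
proof -
  have b: "bij (\<sigma> ^^ i)" for i by (rule bij_fn[OF assms(1)])
  have hs: "((\<lambda>v. \<Sum>i<n. f ((\<sigma> ^^ i) v)) has_sum (real n * infsum f UNIV)) UNIV"
    if f: "f summable_on UNIV" for f :: "'a \<Rightarrow> real"
  proof -
    have "((\<lambda>v. f ((\<sigma> ^^ i) v)) has_sum infsum f UNIV) UNIV" for i
      using has_sum_reindex_bij_betw[OF b, of f] f by simp
    then have "((\<lambda>v. \<Sum>i<n. f ((\<sigma> ^^ i) v)) has_sum (\<Sum>i<n. infsum f UNIV)) UNIV"
      by (induction n) (simp_all add: has_sum_add del: sum_constant)
    then show ?thesis by simp
  qed
  have "real n * infsum \<phi> UNIV \<le> real n * infsum \<psi> UNIV"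
    by (rule has_sum_mono[OF hs hs]) (use assms in auto)
  then show ?thesis using assms(2) by simp
qed

text \<open>The limit is taken vertex by vertex: \<open>cont\<close> asks for continuity under
  pointwise convergence, as finite-range operators have, and the norm bound survives because it is
  tested on finite sets.\<close>

lemma neumann_series:
  fixes R :: "('a \<Rightarrow> complex) \<Rightarrow> 'a \<Rightarrow> complex"
  assumes diff: "\<And>f h v. R (\<lambda>u. f u - h u) v = R f v - R h v"
    and contr: "\<And>f. f \<in> ell2 \<Longrightarrow> R f \<in> ell2" "\<And>f. f \<in> ell2 \<Longrightarrow> ell2_norm (R f) \<le> q * ell2_norm f"
    and cont: "\<And>s f v. (\<And>u. (\<lambda>n. s n u) \<longlonglongrightarrow> f u) \<Longrightarrow> (\<lambda>n. R (s n) v) \<longlonglongrightarrow> R f v"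
    and q: "0 \<le> q" "q < 1" and g: "g \<in> ell2"
  obtains f where "f \<in> ell2" "\<And>v. f v = g v + R f v" "ell2_norm f \<le> ell2_norm g / (1 - q)"
proof -
  \<comment> \<open>The iterates are the partial sums of the series; the increments
    \<open>d n\<close> below are \<open>R\<close> applied \<open>n\<close> times to
    \<open>g\<close>.\<close>
  define s where "s n = ((\<lambda>h v. g v + R h v) ^^ n) (\<lambda>v. 0)" for n
  have s0: "s 0 = (\<lambda>v. 0)" and sS: "s (Suc n) = (\<lambda>v. g v + R (s n) v)" for n
    by (simp_all add: s_def)
  \<comment> \<open>The fixed point of \<open>K = ell2_norm g + q * K\<close>, so the iteration
    preserves this bound.\<close>
  let ?K = "ell2_norm g / (1 - q)"
  have sb: "s n \<in> ell2 \<and> ell2_norm (s n) \<le> ?K" for n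
  proof (induction n)
    case 0 then show ?case using q by (simp add: s0)
  next
    case (Suc n)
    then have m: "s n \<in> ell2" and le: "ell2_norm (s n) \<le> ?K" by auto
    have "ell2_norm (s (Suc n)) \<le> ell2_norm g + ell2_norm (R (s n))"
      unfolding sS by (rule ell2_add(2)[OF g contr(1)[OF m]])
    also have "\<dots> \<le> ell2_norm g + q * ?K"
      using contr(2)[OF m] mult_left_mono[OF le q(1)] by linarith
    also have "\<dots> = ?K" using q by (simp add: field_simps)
    finally show ?case unfolding sS using ell2_add(1)[OF g contr(1)[OF m]] by simp
  qed
  define d where "d n = (\<lambda>v. s (Suc n) v - s n v)" for n
  have d0: "d 0 = (\<lambda>v. g v + R (\<lambda>v. 0) v)" by (simp add: d_def sS s0)
  have R0: "R (\<lambda>v. 0) = (\<lambda>v. 0)" using diff[of "\<lambda>v. 0" "\<lambda>v. 0"] by (auto simp: fun_eq_iff)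
  have dS: "d (Suc n) = R (d n)" for n
    unfolding d_def diff by (simp add: sS)
  have db: "d n \<in> ell2 \<and> ell2_norm (d n) \<le> q ^ n * ell2_norm g" for n
  proof (induction n)
    case 0 then show ?case using g by (simp add: d0 R0)
  next
    case (Suc n)
    then have "ell2_norm (R (d n)) \<le> q * (q ^ n * ell2_norm g)"
      using contr(2)[of "d n"] q mult_left_mono[of "ell2_norm (d n)" "q ^ n * ell2_norm g" q] by linarith
    then show ?case using Suc contr(1) by (simp add: dS)
  qed
  define f where "f v = (\<Sum>n. d n v)" for v
  have lim: "(\<lambda>n. s n v) \<longlonglongrightarrow> f v" for v
  proof -
    have "summable (\<lambda>n. d n v)"
    proof (rule summable_comparison_test')
      show "summable (\<lambda>n. q ^ n * ell2_norm g)"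
        using q by (intro summable_mult2 summable_geometric) simp
      show "norm (d n v) \<le> q ^ n * ell2_norm g" for n
        using norm_le_ell2_norm[of "d n" v] db[of n] by linarith
    qed
    then have "(\<lambda>n. \<Sum>i<n. d i v) \<longlonglongrightarrow> f v"
      unfolding f_def by (rule summable_LIMSEQ)
    moreover have "(\<Sum>i<n. d i v) = s n v" for n
      unfolding d_def using sum_lessThan_telescope[of "\<lambda>i. s i v" n] by (simp add: s0)
    ultimately show ?thesis by simp
  qed
  have "L2_set (\<lambda>v. cmod (f v)) F \<le> ?K" if "finite F" for F
  proof (rule LIMSEQ_le_const2)
    show "(\<lambda>n. L2_set (\<lambda>v. cmod (s n v)) F) \<longlonglongrightarrow> L2_set (\<lambda>v. cmod (f v)) F"
      unfolding L2_set_def by (intro tendsto_intros lim)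
    show "\<exists>N. \<forall>n\<ge>N. L2_set (\<lambda>v. cmod (s n v)) F \<le> ?K"
      using L2_set_le_ell2_norm[OF _ that] sb by (meson order_trans)
  qed
  note fb = ell2_leI[OF this]
  have "f v = g v + R f v" for v
  proof (rule LIMSEQ_unique)
    show "(\<lambda>n. s (Suc n) v) \<longlonglongrightarrow> f v" using lim by (rule LIMSEQ_Suc)
    show "(\<lambda>n. s (Suc n) v) \<longlonglongrightarrow> g v + R f v"
      unfolding sS by (intro tendsto_intros cont lim)
  qed
  with fb that show thesis by blast
qed

text \<open>By injectivity, any solution found in \<open>X\<close> is the value of
  \<open>inv_into\<close>, so a bound on some solution is a bound on the inverse.\<close>

lemma in_resolvent_setI:
  assumes maps: "\<And>f. f \<in> X \<Longrightarrow> (\<lambda>v. T f v - z * f v) \<in> X"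
    and inj: "\<And>f h. \<lbrakk>f \<in> X; h \<in> X; \<And>v. T f v - z * f v = T h v - z * h v\<rbrakk> \<Longrightarrow> f = h"
    and solve: "\<And>g. g \<in> X \<Longrightarrow> \<exists>f\<in>X. (\<forall>v. T f v - z * f v = g v) \<and> N f \<le> C * N g"
  shows "z \<in> resolvent_set X N T"
proof -
  let ?S = "\<lambda>f v. T f v - z * f v"
  have i: "inj_on ?S X" by (intro inj_onI inj) (auto simp: fun_eq_iff)
  have "?S ` X = X"
  proof
    show "X \<subseteq> ?S ` X"
    proof
      fix g assume "g \<in> X"
      from solve[OF this] obtain f where "f \<in> X" "?S f = g" by (auto simp: fun_eq_iff)
      then show "g \<in> ?S ` X" by blast
    qed
  qed (use maps in auto)
  moreover have "N (inv_into X ?S g) \<le> C * N g" if g: "g \<in> X" for g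
  proof -
    from solve[OF g] obtain f where f: "f \<in> X" "?S f = g" "N f \<le> C * N g" by (auto simp: fun_eq_iff)
    then have "inv_into X ?S g = f" using inv_into_f_f[OF i f(1)] by simp
    with f show ?thesis by simp
  qed
  ultimately show ?thesis
    using i unfolding resolvent_set_def bij_betw_def by (auto simp: Let_def)
qed

text \<open>\<open>T\<close> is an arbitrary map here, so its value at the zero function is an
  assumption; \<open>f\<close> and zero then share an image and injectivity fails.\<close>

lemma in_op_spectrumI_kernel:
  assumes "f \<in> X" "(\<lambda>v. 0) \<in> X" "\<And>v. T f v = z * f v" "\<And>v. T (\<lambda>v. 0) v = 0" "f v \<noteq> 0"
  shows "z \<in> op_spectrum X N T"
proof -
  let ?S = "\<lambda>f v. T f v - z * f v"
  have "?S f = ?S (\<lambda>v. 0)" using assms(3,4) by simp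
  moreover have "f \<noteq> (\<lambda>v. 0)" using assms(5) by auto
  ultimately have "\<not> inj_on ?S X" using assms(1,2) by (meson inj_onD)
  then show ?thesis by (simp add: op_spectrum_def resolvent_set_def Let_def bij_betw_def)
qed

text \<open>Weyl's criterion: a bounded inverse keeps the relative error of approximate
  eigenfunctions away from zero.\<close>

lemma in_op_spectrumI_approx:
  assumes "\<And>\<epsilon>. \<epsilon> > 0 \<Longrightarrow> \<exists>f\<in>X. 0 < N f \<and> N (\<lambda>v. T f v - z * f v) \<le> \<epsilon> * N f"
    and nonneg: "\<And>f. 0 \<le> N f"
  shows "z \<in> op_spectrum X N T"
proof (rule ccontr)
  let ?S = "\<lambda>f v. T f v - z * f v"
  assume "z \<notin> op_spectrum X N T"
  then obtain C where b: "bij_betw ?S X X" and C: "\<And>g. g \<in> X \<Longrightarrow> N (inv_into X ?S g) \<le> C * N g"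
    by (auto simp: op_spectrum_def resolvent_set_def Let_def)
  \<comment> \<open>\<open>C\<close> may be zero or negative; \<open>D\<close> is a positive upper
    bound for it, and the tolerance \<open>1 / (2 * D)\<close> yields
    \<open>N f \<le> N f / 2\<close>.\<close>
  define D where "D = \<bar>C\<bar> + 1"
  have D: "D > 0" "C \<le> D" by (auto simp: D_def)
  obtain f where f: "f \<in> X" "0 < N f" "N (?S f) \<le> 1 / (2 * D) * N f"
    using assms(1)[of "1 / (2 * D)"] D by auto
  have "?S f \<in> X" using b f(1) by (auto simp: bij_betw_def)
  then have "N f \<le> C * N (?S f)"
    using C[of "?S f"] inv_into_f_f[of ?S X f] b f(1) by (simp add: bij_betw_def)
  also have "\<dots> \<le> D * N (?S f)" using D nonneg by (intro mult_right_mono) auto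
  also have "\<dots> \<le> D * (1 / (2 * D) * N f)" using D f(3) by (intro mult_left_mono) auto
  also have "\<dots> = N f / 2" using D by simp
  finally show False using f(2) by simp
qed

subsection \<open>The Laplacian in terms of a projection and an involution\<close>

text \<open>\<open>rot\<close> cycles the vertices of a triangle, all in one cell, and
  \<open>flip\<close> crosses the edge between two dodecagons, so the neighbours of \<open>v\<close>
  are \<open>rot v\<close>, \<open>rot (rot v)\<close> and \<open>flip v\<close>.\<close>

fun rot_site :: "site \<Rightarrow> site" where
  "rot_site V1 = V2" | "rot_site V2 = V3" | "rot_site V3 = V1"
| "rot_site V4 = V5" | "rot_site V5 = V6" | "rot_site V6 = V4"

definition rot :: "vertex \<Rightarrow> vertex" where
  "rot v = (rot_site (fst v), snd v)"

fun flip_site :: "site \<Rightarrow> site" where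
  "flip_site V1 = V5" | "flip_site V2 = V6" | "flip_site V3 = V4"
| "flip_site V4 = V3" | "flip_site V5 = V1" | "flip_site V6 = V2"

fun flip_shift :: "site \<Rightarrow> int \<times> int" where
  "flip_shift V1 = (0, 1)" | "flip_shift V2 = (1, 0)" | "flip_shift V3 = (0, 0)"
| "flip_shift V4 = (0, 0)" | "flip_shift V5 = (0, -1)" | "flip_shift V6 = (-1, 0)"

definition flip :: "vertex \<Rightarrow> vertex" where
  "flip v = (flip_site (fst v), snd v + flip_shift (fst v))"

lemma rot3 [simp]: "rot (rot (rot v)) = v"
  by (cases v; cases "fst v") (auto simp: rot_def)

lemma flip2 [simp]: "flip (flip v) = v"
  by (cases v; cases "fst v") (auto simp: flip_def)

lemma bij_rot: "bij rot"
  by (rule o_bij[where g = "\<lambda>v. rot (rot v)"]) (auto simp: fun_eq_iff)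

lemma bij_flip: "bij flip"
  by (rule o_bij[where g = flip]) (auto simp: fun_eq_iff)

text \<open>One orientation of each bond. There is no recursive symmetry rule, so
  \<open>arc.simps\<close> can be checked site by site.\<close>

inductive arc :: "nat \<Rightarrow> vertex \<Rightarrow> vertex \<Rightarrow> bool" where
  "arc 1 (V5, b) (V6, b)"
| "arc 2 (V4, b) (V6, b)"
| "arc 3 (V4, b) (V5, b)"
| "arc 4 (V1, b) (V2, b)"
| "arc 5 (V2, b) (V3, b)"
| "arc 6 (V1, b) (V3, b)"
| "arc 7 (V3, b) (V4, b)"
| "arc 8 (V2, b) (V6, b + (1, 0))"
| "arc 9 (V1, b) (V5, b + (0, 1))"

lemma bond_iff_arc: "bond k v w \<longleftrightarrow> arc k v w \<or> arc k w v"
proof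
  show "bond k v w \<Longrightarrow> arc k v w \<or> arc k w v"
    by (induction rule: bond.induct) (blast intro: arc.intros)+
  have "arc k v w \<Longrightarrow> bond k v w" for v w
    by (induction rule: arc.induct) (blast intro: bond.intros)+
  then show "arc k v w \<or> arc k w v \<Longrightarrow> bond k v w"
    by (blast intro: bond_sym)
qed

text \<open>\<open>tri_class j\<close> belongs to the edge from \<open>j\<close> to
  \<open>rot_site j\<close>. The edge from \<open>v\<close> to \<open>rot (rot v)\<close> is
  therefore indexed by its far end, from which one more rotation leads back to
  \<open>v\<close>.\<close>

fun tri_class :: "site \<Rightarrow> nat" where
  "tri_class V1 = 4" | "tri_class V2 = 5" | "tri_class V3 = 6"
| "tri_class V4 = 3" | "tri_class V5 = 1" | "tri_class V6 = 2"

fun flip_class :: "site \<Rightarrow> nat" where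
  "flip_class V1 = 9" | "flip_class V2 = 8" | "flip_class V3 = 7"
| "flip_class V4 = 7" | "flip_class V5 = 9" | "flip_class V6 = 8"

lemma bond_iff:
  "bond k v w \<longleftrightarrow> w = rot v \<and> k = tri_class (fst v)
     \<or> w = rot (rot v) \<and> k = tri_class (rot_site (rot_site (fst v)))
     \<or> w = flip v \<and> k = flip_class (fst v)"
proof -
  obtain j a b where v: "v = (j, a, b)" by (cases v)
  obtain i c d where w: "w = (i, c, d)" by (cases w)
  show ?thesis
    unfolding bond_iff_arc v w
    by (cases j; cases i) (auto simp: arc.simps rot_def flip_def)
qed

lemma neighbours_distinct: "rot v \<noteq> rot (rot v)" "rot v \<noteq> flip v" "rot (rot v) \<noteq> flip v"
  by (cases v; cases "fst v"; simp add: rot_def flip_def)+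

definition avg :: "(vertex \<Rightarrow> complex) \<Rightarrow> vertex \<Rightarrow> complex" where
  "avg f v = (f v + f (rot v) + f (rot (rot v))) / 3"

definition hop :: "complex \<Rightarrow> complex \<Rightarrow> (vertex \<Rightarrow> complex) \<Rightarrow> vertex \<Rightarrow> complex" where
  "hop p q f v = p * avg f v + q * f (flip v)"

lemma laplacian_eq:
  fixes \<alpha> \<beta> :: real and f :: "vertex \<Rightarrow> complex"
  assumes "\<forall>k\<in>{1..6}. \<gamma> k = \<alpha>" "\<forall>k\<in>{7..9}. \<gamma> k = \<beta>"
  shows "laplacian \<mu> \<gamma> f v =
    f v - complex_of_real (1 / \<mu>) * (\<alpha> * (f (rot v) + f (rot (rot v))) + \<beta> * f (flip v))"
proof -
  have tc: "1 \<le> tri_class j \<and> tri_class j \<le> 6" and fc: "7 \<le> flip_class j \<and> flip_class j \<le> 9" for j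
    by (cases j; simp)+
  have adj: "{w. adj v w} = {rot v, rot (rot v), flip v}"
    by (auto simp: adj_def bond_iff)
  note d = neighbours_distinct[of v]
  have "{k. k \<in> {1..9} \<and> bond k v (rot v)} = {tri_class (fst v)}"
    using d tc[of "fst v"] by (auto simp: bond_iff)
  then have w1: "weight \<gamma> v (rot v) = \<alpha>"
    unfolding weight_def using assms(1) tc[of "fst v"] by simp
  have "{k. k \<in> {1..9} \<and> bond k v (rot (rot v))} = {tri_class (rot_site (rot_site (fst v)))}"
    using d tc[of "rot_site (rot_site (fst v))"] by (auto simp: bond_iff)
  then have w2: "weight \<gamma> v (rot (rot v)) = \<alpha>"
    unfolding weight_def using assms(1) tc[of "rot_site (rot_site (fst v))"] by simp
  have "{k. k \<in> {1..9} \<and> bond k v (flip v)} = {flip_class (fst v)}"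
    using d fc[of "fst v"] by (auto simp: bond_iff)
  then have w3: "weight \<gamma> v (flip v) = \<beta>"
    unfolding weight_def using assms(2) fc[of "fst v"] by simp
  show ?thesis
    unfolding laplacian_def adj using d w1 w2 w3 by (simp add: algebra_simps)
qed

text \<open>\<open>avg\<close> includes the vertex itself, so \<open>3 * \<alpha> * avg f v\<close>
  exceeds the triangle part of the neighbour sum by \<open>\<alpha> * f v\<close>; this is the shift
  by \<open>\<alpha>\<close> in the spectral parameter.\<close>

lemma laplacian_minus:
  fixes \<alpha> \<beta> :: real and f :: "vertex \<Rightarrow> complex" and z :: complex
  assumes "\<forall>k\<in>{1..6}. \<gamma> k = \<alpha>" "\<forall>k\<in>{7..9}. \<gamma> k = \<beta>" "\<mu> \<noteq> 0"
  shows "laplacian \<mu> \<gamma> f v - z * f v =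
    complex_of_real (1 / \<mu>) * ((\<mu> * (1 - z) + \<alpha>) * f v - hop (3 * \<alpha>) \<beta> f v)"
  using assms(3) unfolding laplacian_eq[OF assms(1,2)] hop_def avg_def
  by (simp add: field_simps)

definition core :: "(vertex \<Rightarrow> complex) \<Rightarrow> vertex \<Rightarrow> complex" where
  "core f v = avg (\<lambda>u. f (flip u)) v + avg f (flip v) - f (flip v)"

text \<open>From \<open>P^2 = P\<close> and \<open>S^2 = 1\<close> one gets
  \<open>B^2 - p B = q^2 + p q W\<close>. The first order of the factors serves to produce
  solutions, the second to prove injectivity.\<close>

lemma hop_factorization:
  assumes "l\<^sup>2 - p * l - q\<^sup>2 = p * q * w"
  shows "l * ((l - p) * f v + hop p q f v) - hop p q (\<lambda>u. (l - p) * f u + hop p q f u) v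
           = p * q * (w * f v - core f v)"
    and "(l - p) * (l * f v - hop p q f v) + hop p q (\<lambda>u. l * f u - hop p q f u) v
           = p * q * (w * f v - core f v)"
proof -
  have *: "p * q * (w * f v - core f v) = (l\<^sup>2 - p * l - q\<^sup>2) * f v - p * q * core f v"
    by (simp add: assms right_diff_distrib)
  show "l * ((l - p) * f v + hop p q f v) - hop p q (\<lambda>u. (l - p) * f u + hop p q f u) v
           = p * q * (w * f v - core f v)"
    unfolding * by (simp add: hop_def avg_def core_def field_simps power2_eq_square)
  show "(l - p) * (l * f v - hop p q f v) + hop p q (\<lambda>u. l * f u - hop p q f u) v
           = p * q * (w * f v - core f v)"
    unfolding * by (simp add: hop_def avg_def core_def field_simps power2_eq_square)
qed

subsection \<open>Resolvent estimates\<close>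

lemma ell2_avg: "f \<in> ell2 \<Longrightarrow> avg f \<in> ell2"
proof -
  assume f: "f \<in> ell2"
  have "(\<lambda>v. (1 / 3) * (f v + (f (rot v) + f (rot (rot v))))) \<in> ell2"
    using f by (intro ell2_scale ell2_add ell2_permute[OF bij_rot] ell2_permute[OF bij_rot, of "\<lambda>v. f (rot v)"])
  then show ?thesis by (simp add: avg_def[abs_def] add.assoc)
qed

lemma ell2_flip: "f \<in> ell2 \<Longrightarrow> (\<lambda>v. f (flip v)) \<in> ell2"
  by (rule ell2_permute[OF bij_flip])

section \<open>Norm bounds by orthogonal decomposition\<close>

lemma parallelogram: "(cmod (x + y))\<^sup>2 + (cmod (x - y))\<^sup>2 = 2 * (cmod x)\<^sup>2 + 2 * (cmod y)\<^sup>2"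
  unfolding cmod_power2 by (simp add: power2_eq_square algebra_simps)

text \<open>The swap of \<open>x\<close> and \<open>y\<close> is diagonal in \<open>x + y\<close>
  and \<open>x - y\<close>, with factors \<open>a + b\<close> and \<open>a - b\<close>; the
  parallelogram law passes to these coordinates and back.\<close>

lemma flip_bound_pointwise:
  assumes "cmod (a + b) \<le> M" "cmod (a - b) \<le> M"
  shows "(cmod (a * x + b * y))\<^sup>2 + (cmod (a * y + b * x))\<^sup>2 \<le> M\<^sup>2 * ((cmod x)\<^sup>2 + (cmod y)\<^sup>2)"
proof -
  have "2 * ((cmod (a * x + b * y))\<^sup>2 + (cmod (a * y + b * x))\<^sup>2) =
      (cmod ((a + b) * (x + y)))\<^sup>2 + (cmod ((a - b) * (x - y)))\<^sup>2"
    using parallelogram[of "a * x + b * y" "a * y + b * x"] by (simp add: algebra_simps)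
  also have "\<dots> \<le> M\<^sup>2 * (cmod (x + y))\<^sup>2 + M\<^sup>2 * (cmod (x - y))\<^sup>2"
    using assms unfolding norm_mult power_mult_distrib
    by (intro add_mono mult_right_mono power_mono) auto
  also have "\<dots> = 2 * (M\<^sup>2 * ((cmod x)\<^sup>2 + (cmod y)\<^sup>2))"
    unfolding distrib_left[symmetric] parallelogram by (simp add: algebra_simps)
  finally show ?thesis by simp
qed

lemma ell2_norm_flip_comb:
  assumes "cmod (a + b) \<le> M" "cmod (a - b) \<le> M" "f \<in> ell2"
  shows "(ell2_norm (\<lambda>v. a * f v + b * f (flip v)))\<^sup>2 \<le> M\<^sup>2 * (ell2_norm f)\<^sup>2"
proof -
  have m: "(\<lambda>v. a * f v + b * f (flip v)) \<in> ell2"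
    using assms(3) by (intro ell2_add ell2_scale ell2_flip)
  have "(\<Sum>\<^sub>\<infinity>v. (cmod (a * f v + b * f (flip v)))\<^sup>2) \<le> (\<Sum>\<^sub>\<infinity>v. M\<^sup>2 * (cmod (f v))\<^sup>2)"
  proof (rule infsum_orbit_mono[OF bij_flip, of 2])
    show "(\<lambda>v. M\<^sup>2 * (cmod (f v))\<^sup>2) summable_on UNIV"
      using assms(3) by (simp add: ell2_def summable_on_cmult_right)
    show "(\<Sum>i<2. (cmod (a * f ((flip ^^ i) v) + b * f (flip ((flip ^^ i) v))))\<^sup>2)
        \<le> (\<Sum>i<2. M\<^sup>2 * (cmod (f ((flip ^^ i) v)))\<^sup>2)" for v
      using flip_bound_pointwise[OF assms(1,2), of "f v" "f (flip v)"]
      by (simp add: eval_nat_numeral algebra_simps)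
  qed (use m in \<open>auto simp: ell2_def\<close>)
  then show ?thesis by (simp add: ell2_norm_square infsum_cmult_right')
qed

lemma pythagoras_pointwise:
  fixes p x y z :: complex
  assumes "x + y + z = 0"
  shows "(cmod (p + x))\<^sup>2 + (cmod (p + y))\<^sup>2 + (cmod (p + z))\<^sup>2
    = 3 * (cmod p)\<^sup>2 + ((cmod x)\<^sup>2 + (cmod y)\<^sup>2 + (cmod z)\<^sup>2)"
proof -
  have z: "z = - (x + y)" using minus_unique[OF assms] by simp
  show ?thesis unfolding z cmod_power2 by (simp add: power2_eq_square algebra_simps)
qed

text \<open>On every triangle the first summand is constant and the second has sum zero, so they are
  orthogonal. Distinct \<open>f\<close> and \<open>g\<close> serve the two blocks of
  \<open>core\<close>; \<open>f = g\<close> shows that both projections are contractions.\<close>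

lemma avg_pythagoras:
  assumes "f \<in> ell2" "g \<in> ell2"
  shows "(ell2_norm (\<lambda>v. avg f v + (g v - avg g v)))\<^sup>2
    = (ell2_norm (avg f))\<^sup>2 + (ell2_norm (\<lambda>v. g v - avg g v))\<^sup>2"
proof -
  let ?h = "\<lambda>v. avg f v + (g v - avg g v)"
  let ?k = "\<lambda>v. (cmod (avg f v))\<^sup>2 + (cmod (g v - avg g v))\<^sup>2"
  have s1: "(\<lambda>v. (cmod (avg f v))\<^sup>2) summable_on UNIV"
    using ell2_avg[OF assms(1)] by (simp add: ell2_def)
  have s2: "(\<lambda>v. (cmod (g v - avg g v))\<^sup>2) summable_on UNIV"
    using ell2_diff[OF assms(2) ell2_avg[OF assms(2)]] by (simp add: ell2_def)
  have s: "(\<lambda>v. (cmod (?h v))\<^sup>2) summable_on UNIV"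
    using ell2_add(1)[OF ell2_avg[OF assms(1)] ell2_diff[OF assms(2) ell2_avg[OF assms(2)]]]
    by (simp add: ell2_def)
  have eq: "(\<Sum>i<3. (cmod (?h ((rot ^^ i) v)))\<^sup>2) = (\<Sum>i<3. ?k ((rot ^^ i) v))" for v
  proof -
    have a: "avg u (rot v) = avg u v" "avg u (rot (rot v)) = avg u v" for u
      by (simp_all add: avg_def add_ac)
    have "(g v - avg g v) + (g (rot v) - avg g v) + (g (rot (rot v)) - avg g v) = 0"
      by (simp add: avg_def field_simps)
    from pythagoras_pointwise[OF this, of "avg f v"] show ?thesis
      by (simp add: eval_nat_numeral a)
  qed
  have "infsum (\<lambda>v. (cmod (?h v))\<^sup>2) UNIV = infsum ?k UNIV"
    by (intro antisym infsum_orbit_mono[OF bij_rot, of 3] s summable_on_add s1 s2)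
       (use eq in auto)
  then show ?thesis using infsum_add[OF s1 s2] by (simp add: ell2_norm_square)
qed

text \<open>In block form with respect to \<open>avg\<close> and its complement, \<open>core\<close> is the diagonal part of
  \<open>flip\<close> with the sign of the second block reversed; hence it is bounded like \<open>flip\<close>.\<close>

lemma ell2_norm_core_comb:
  assumes M: "cmod (a + b) \<le> M" "cmod (a - b) \<le> M" and f: "f \<in> ell2"
  shows "(\<lambda>v. a * f v + b * core f v) \<in> ell2"
    and "ell2_norm (\<lambda>v. a * f v + b * core f v) \<le> M * ell2_norm f"
proof -
  define g where "g v = f v - avg f v" for v
  \<comment> \<open>\<open>avg x\<close> is the block \<open>P (a + b S) P f\<close>, and
    \<open>y - avg y\<close> is the block of \<open>1 - P\<close> with \<open>b\<close> negated,
    which only exchanges the two conditions in \<open>M\<close>.\<close>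
  define x where "x v = a * avg f v + b * avg f (flip v)" for v
  define y where "y v = a * g v + (- b) * g (flip v)" for v
  have af: "avg f \<in> ell2" by (rule ell2_avg[OF f])
  have g: "g \<in> ell2" unfolding g_def by (rule ell2_diff[OF f af])
  have x: "x \<in> ell2" unfolding x_def by (intro ell2_add ell2_scale ell2_flip af)
  have y: "y \<in> ell2" unfolding y_def by (intro ell2_add ell2_scale ell2_flip g)
  have ay: "avg y \<in> ell2" and ax: "avg x \<in> ell2" by (intro ell2_avg x y)+
  have eq: "(\<lambda>v. a * f v + b * core f v) = (\<lambda>v. avg x v + (y v - avg y v))"
    unfolding core_def x_def y_def g_def avg_def by (rule ext) (simp add: field_simps)
  show "(\<lambda>v. a * f v + b * core f v) \<in> ell2"
    unfolding eq by (intro ell2_add ell2_diff ax ay y)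
  have contr: "(ell2_norm (avg u))\<^sup>2 \<le> (ell2_norm u)\<^sup>2"
    "(ell2_norm (\<lambda>v. u v - avg u v))\<^sup>2 \<le> (ell2_norm u)\<^sup>2" if "u \<in> ell2" for u
    using avg_pythagoras[OF that that] by simp_all
  have "(ell2_norm (\<lambda>v. a * f v + b * core f v))\<^sup>2
      = (ell2_norm (avg x))\<^sup>2 + (ell2_norm (\<lambda>v. y v - avg y v))\<^sup>2"
    unfolding eq by (rule avg_pythagoras[OF x y])
  also have "\<dots> \<le> (ell2_norm x)\<^sup>2 + (ell2_norm y)\<^sup>2"
    by (intro add_mono contr x y)
  also have "\<dots> \<le> M\<^sup>2 * (ell2_norm (avg f))\<^sup>2 + M\<^sup>2 * (ell2_norm g)\<^sup>2"
    unfolding x_def y_def using M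
    by (intro add_mono ell2_norm_flip_comb af g) simp_all
  also have "\<dots> = M\<^sup>2 * (ell2_norm f)\<^sup>2"
    using avg_pythagoras[OF f f] by (simp add: g_def[abs_def] distrib_left)
  finally have "(ell2_norm (\<lambda>v. a * f v + b * core f v))\<^sup>2 \<le> (M * ell2_norm f)\<^sup>2"
    by (simp add: power_mult_distrib)
  moreover have "0 \<le> M" using M(1) norm_ge_zero order_trans by blast
  ultimately show "ell2_norm (\<lambda>v. a * f v + b * core f v) \<le> M * ell2_norm f"
    using power2_le_imp_le by (metis ell2_norm_nonneg mult_nonneg_nonneg)
qed

text \<open>Some open half-plane with \<open>0\<close> on its boundary contains \<open>w - 1\<close>
  and \<open>w + 1\<close>. A rotation \<open>\<zeta>\<close> makes both real parts positive, and a
  short step \<open>t\<close> then wins, since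
  \<open>|1 - t p|^2 = 1 - 2 t Re p + t^2 |p|^2\<close>.\<close>

lemma relaxation_parameter:
  fixes w :: complex
  assumes "w \<notin> complex_of_real ` {-1..1}"
  obtains \<tau> where "cmod (1 - \<tau> * (w - 1)) < 1" "cmod (1 - \<tau> * (w + 1)) < 1"
proof -
  have contract: "cmod (1 - of_real t * \<zeta> * p) < 1"
    if "0 < t" "t * (cmod p)\<^sup>2 < 2 * Re (\<zeta> * p)" "cmod \<zeta> = 1" for t \<zeta> p
  proof -
    have "(cmod (1 - of_real t * (\<zeta> * p)))\<^sup>2 = 1 + t * (t * (cmod (\<zeta> * p))\<^sup>2 - 2 * Re (\<zeta> * p))"
      unfolding cmod_power2 by (simp add: power2_eq_square algebra_simps)
    also have "\<dots> < 1"
      using that by (simp add: norm_mult mult_pos_neg)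
    finally show ?thesis by (simp add: mult.assoc power2_less_1_iff abs_square_less_1)
  qed
  \<comment> \<open>For real \<open>w\<close> the sign of \<open>w\<close> decides; otherwise
    multiplication by \<open>- \<i>\<close> or \<open>\<i>\<close> turns the common imaginary part
    of \<open>w - 1\<close> and \<open>w + 1\<close> into a positive real part.\<close>
  obtain \<zeta> where \<zeta>: "cmod \<zeta> = 1" "0 < Re (\<zeta> * (w - 1))" "0 < Re (\<zeta> * (w + 1))"
  proof (cases "Im w = 0")
    case True
    then have "w = of_real (Re w)" by (simp add: complex_eq_iff)
    with assms have "Re w \<notin> {-1..1}" by (metis imageI)
    then show ?thesis
      using that[of 1] that[of "-1"] by auto
  next
    case False
    then show ?thesis
      using that[of "- \<i>"] that[of "\<i>"] by (cases "Im w > 0") auto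
  qed
  \<comment> \<open>The step length is \<open>c / K\<close>: then
    \<open>t * |p|^2 \<le> c < 2 * c \<le> 2 * Re (\<zeta> * p)\<close> for both points. The summand
    \<open>1\<close> keeps \<open>K\<close> positive.\<close>
  define c where "c = min (Re (\<zeta> * (w - 1))) (Re (\<zeta> * (w + 1)))"
  define K where "K = (cmod (w - 1))\<^sup>2 + (cmod (w + 1))\<^sup>2 + 1"
  have c: "0 < c" "c \<le> Re (\<zeta> * (w - 1))" "c \<le> Re (\<zeta> * (w + 1))" using \<zeta> by (auto simp: c_def)
  have K: "0 < K" "(cmod (w - 1))\<^sup>2 \<le> K" "(cmod (w + 1))\<^sup>2 \<le> K"
    by (auto simp: K_def intro: add_nonneg_pos)
  have key: "c / K * (cmod p)\<^sup>2 < 2 * Re (\<zeta> * p)" if "(cmod p)\<^sup>2 \<le> K" "c \<le> Re (\<zeta> * p)" for p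
  proof -
    have key: "c / K * (cmod p)\<^sup>2 \<le> c / K * K" using c K that by (intro mult_left_mono) auto
    then show ?thesis using c K that by simp
  qed
  show thesis
    by (intro that[of "of_real (c / K) * \<zeta>"] contract key divide_pos_pos c K \<zeta>(1))
qed

lemma ell2_hop:
  assumes "f \<in> ell2"
  shows "hop p q f \<in> ell2" "ell2_norm (hop p q f) \<le> (cmod p + cmod q) * ell2_norm f"
proof -
  note * = ell2_add[OF ell2_scale(1)[OF ell2_avg[OF assms], of p]
      ell2_scale(1)[OF ell2_flip[OF assms], of q]]
  then show "hop p q f \<in> ell2" by (simp add: hop_def[abs_def])
  have "(ell2_norm (avg f))\<^sup>2 \<le> (ell2_norm f)\<^sup>2"
    using avg_pythagoras[OF assms assms] by simp
  then have "ell2_norm (avg f) \<le> ell2_norm f" by simp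
  then have "cmod p * ell2_norm (avg f) \<le> cmod p * ell2_norm f" by (rule mult_left_mono) simp
  then show "ell2_norm (hop p q f) \<le> (cmod p + cmod q) * ell2_norm f"
    using *(2) assms by (simp add: hop_def[abs_def] ell2_scale ell2_flip ell2_avg
        ell2_permute(2)[OF bij_flip] distrib_right)
qed

lemma core_resolvent:
  assumes w: "w \<notin> complex_of_real ` {-1..1}"
  shows "\<exists>C. \<forall>g\<in>ell2. \<exists>f\<in>ell2. (\<forall>v. w * f v - core f v = g v) \<and> ell2_norm f \<le> C * ell2_norm g"
    and "\<lbrakk>f \<in> ell2; \<And>v. w * f v - core f v = 0\<rbrakk> \<Longrightarrow> f v = 0"
proof -
  obtain \<tau> where \<tau>: "cmod (1 - \<tau> * (w - 1)) < 1" "cmod (1 - \<tau> * (w + 1)) < 1"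
    using relaxation_parameter[OF w] .
  define q where "q = max (cmod (1 - \<tau> * (w - 1))) (cmod (1 - \<tau> * (w + 1)))"
  have q: "0 \<le> q" "q < 1" using \<tau> by (auto simp: q_def le_max_iff_disj)
  \<comment> \<open>\<open>R = 1 - \<tau> (w - W)\<close>, so \<open>f = \<tau> g + R f\<close> is
    equivalent to \<open>(w - W) f = g\<close>; here \<open>\<tau>\<close> is nonzero, as otherwise
    the moduli above would equal \<open>1\<close>.\<close>
  define R where "R f v = (1 - \<tau> * w) * f v + \<tau> * core f v" for f v
  have M: "cmod ((1 - \<tau> * w) + \<tau>) \<le> q" "cmod ((1 - \<tau> * w) - \<tau>) \<le> q"
    by (auto simp: q_def algebra_simps)
  have R: "R f \<in> ell2" "ell2_norm (R f) \<le> q * ell2_norm f" if "f \<in> ell2" for f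
    using ell2_norm_core_comb[OF M that] by (simp_all add: R_def[abs_def])
  have eq: "f v - R f v = \<tau> * (w * f v - core f v)" for f v
    by (simp add: R_def algebra_simps)
  have \<tau>0: "\<tau> \<noteq> 0" using \<tau>(1) by auto
  show "f v = 0" if f: "f \<in> ell2" and z: "\<And>v. w * f v - core f v = 0" for f v
  proof -
    have "R f = f" using eq[of f] z by (simp add: fun_eq_iff)
    then have "ell2_norm f \<le> q * ell2_norm f" using R(2)[OF f] by simp
    then have "(1 - q) * ell2_norm f \<le> 0" by (simp add: algebra_simps)
    then have "ell2_norm f \<le> 0" using q by (simp add: mult_le_0_iff)
    then have "cmod (f v) \<le> 0" using norm_le_ell2_norm[OF f, of v] by linarith
    then show ?thesis by simp
  qed
  have "\<exists>f\<in>ell2. (\<forall>v. w * f v - core f v = g v) \<and> ell2_norm f \<le> cmod \<tau> / (1 - q) * ell2_norm g"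
    if g: "g \<in> ell2" for g
  proof -
    have diff: "R (\<lambda>u. f u - h u) v = R f v - R h v" for f h v
      by (simp add: R_def core_def avg_def field_simps)
    have cont: "(\<lambda>n. R (s n) v) \<longlonglongrightarrow> R f v" if "\<And>u. (\<lambda>n. s n u) \<longlonglongrightarrow> f u" for s f v
      unfolding R_def core_def avg_def by (intro tendsto_intros that) simp_all
    obtain f where f: "f \<in> ell2" "\<And>v. f v = \<tau> * g v + R f v"
      "ell2_norm f \<le> ell2_norm (\<lambda>v. \<tau> * g v) / (1 - q)"
      using neumann_series[of R q, OF diff R cont q ell2_scale(1)[OF g, of \<tau>]] by metis
    have "w * f v - core f v = g v" for v
      using eq[of f v] f(2)[of v] \<tau>0 by (metis add_diff_cancel_right' mult_left_cancel)
    moreover have "ell2_norm f \<le> cmod \<tau> / (1 - q) * ell2_norm g"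
      using f(3) ell2_scale(2)[OF g, of \<tau>] by simp
    ultimately show ?thesis using f(1) by blast
  qed
  then show "\<exists>C. \<forall>g\<in>ell2. \<exists>f\<in>ell2. (\<forall>v. w * f v - core f v = g v) \<and> ell2_norm f \<le> C * ell2_norm g"
    by blast
qed

lemma laplacian_resolvent:
  fixes \<alpha> \<beta> \<mu> :: real and z l w :: complex
  assumes \<gamma>: "\<forall>k\<in>{1..6}. \<gamma> k = \<alpha>" "\<forall>k\<in>{7..9}. \<gamma> k = \<beta>"
    and pos: "\<mu> > 0" "\<alpha> > 0" "\<beta> > 0"
    and l: "l = \<mu> * (1 - z) + \<alpha>" and w: "l\<^sup>2 - 3 * \<alpha> * l - \<beta>\<^sup>2 = 3 * \<alpha> * \<beta> * w"
    and notin: "w \<notin> complex_of_real ` {-1..1}"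
  shows "z \<in> resolvent_set ell2 ell2_norm (laplacian \<mu> \<gamma>)"
proof -
  let ?p = "complex_of_real (3 * \<alpha>)" and ?q = "complex_of_real \<beta>" and ?m = "complex_of_real (1 / \<mu>)"
  let ?H = "hop ?p ?q"
  have lap: "laplacian \<mu> \<gamma> f v - z * f v = ?m * (l * f v - ?H f v)" for f v
    using laplacian_minus[OF \<gamma>] pos by (simp add: l)
  have w': "l\<^sup>2 - ?p * l - ?q\<^sup>2 = ?p * ?q * w" using w by simp
  note fact = hop_factorization[OF w']
  obtain C where C: "\<And>g. g \<in> ell2 \<Longrightarrow>
      \<exists>f\<in>ell2. (\<forall>v. w * f v - core f v = g v) \<and> ell2_norm f \<le> C * ell2_norm g"
    using core_resolvent(1)[OF notin] by blast
  show ?thesis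
  proof (rule in_resolvent_setI)
    show "(\<lambda>v. laplacian \<mu> \<gamma> f v - z * f v) \<in> ell2" if "f \<in> ell2" for f
      unfolding lap using that by (intro ell2_scale ell2_diff ell2_hop)
  next
    fix f h assume fh: "f \<in> ell2" "h \<in> ell2"
      and e: "\<And>v. laplacian \<mu> \<gamma> f v - z * f v = laplacian \<mu> \<gamma> h v - z * h v"
    define d where "d v = f v - h v" for v
    have d: "d \<in> ell2" unfolding d_def by (rule ell2_diff[OF fh])
    have "l * d v - ?H d v = 0" for v
    proof -
      have "l * d v - ?H d v = (l * f v - ?H f v) - (l * h v - ?H h v)"
        by (simp add: d_def hop_def avg_def field_simps)
      also have "\<dots> = 0" using e[of v] pos unfolding lap by simp
      finally show ?thesis .
    qed
    \<comment> \<open>Applying \<open>l - p + B\<close> to the vanishing \<open>l d - B d\<close>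
      leaves \<open>p q (w - W) d\<close>, with \<open>p q\<close> nonzero.\<close>
    then have "w * d v - core d v = 0" for v
      using fact(2)[of d v] pos by (simp add: hop_def avg_def)
    from core_resolvent(2)[OF notin d this] show "f = h" by (simp add: d_def fun_eq_iff)
  next
    fix g :: "vertex \<Rightarrow> complex" assume g: "g \<in> ell2"
    \<comment> \<open>This factor cancels \<open>1 / \<mu>\<close> from the Laplacian and
      \<open>p q\<close> from the factorization.\<close>
    define c where "c = complex_of_real (\<mu> / (3 * \<alpha> * \<beta>))"
    define K where "K = cmod (l - ?p) + (cmod ?p + cmod ?q)"
    obtain h where h: "h \<in> ell2" "\<And>v. w * h v - core h v = c * g v"
      "ell2_norm h \<le> C * ell2_norm (\<lambda>v. c * g v)"
      using C[OF ell2_scale(1)[OF g]] by blast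
    let ?f = "\<lambda>v. (l - ?p) * h v + ?H h v"
    have f: "?f \<in> ell2" using h by (intro ell2_add ell2_scale ell2_hop)
    have "laplacian \<mu> \<gamma> ?f v - z * ?f v = g v" for v
    proof -
      have "laplacian \<mu> \<gamma> ?f v - z * ?f v = ?m * (l * ?f v - ?H ?f v)"
        by (rule lap)
      also have "\<dots> = ?m * (?p * ?q * (c * g v))"
        by (simp only: fact(1) h(2))
      also have "\<dots> = g v" using pos by (simp add: c_def)
      finally show ?thesis .
    qed
    moreover have "ell2_norm ?f \<le> K * (C * cmod c) * ell2_norm g"
    proof -
      have "ell2_norm ?f \<le> K * ell2_norm h"
        using ell2_add(2)[OF ell2_scale(1)[OF h(1), of "l - ?p"] ell2_hop(1)[OF h(1), of ?p ?q]]
          ell2_hop(2)[OF h(1), of ?p ?q] ell2_scale(2)[OF h(1), of "l - ?p"]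
        by (simp add: K_def distrib_right)
      also have "\<dots> \<le> K * (C * ell2_norm (\<lambda>v. c * g v))"
        using h(3) by (rule mult_left_mono) (simp add: K_def)
      finally show ?thesis by (simp add: ell2_scale(2)[OF g] mult_ac)
    qed
    ultimately show "\<exists>f\<in>ell2. (\<forall>v. laplacian \<mu> \<gamma> f v - z * f v = g v) \<and>
        ell2_norm f \<le> K * (C * cmod c) * ell2_norm g"
      using f by blast
  qed
qed

subsection \<open>Bloch functions and approximate eigenfunctions\<close>

definition phase :: "real \<times> real \<Rightarrow> int \<times> int \<Rightarrow> complex" where
  "phase \<theta> b = exp (\<i> * complex_of_real (\<theta> \<bullet> (real_of_int (fst b), real_of_int (snd b))))"

lemma phase_add: "phase \<theta> (b + c) = phase \<theta> b * phase \<theta> c"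
  by (cases \<theta>) (simp add: phase_def flip: exp_add, simp add: algebra_simps)

lemma norm_phase [simp]: "cmod (phase \<theta> b) = 1"
  by (simp add: phase_def)

lemma phase_simps [simp]: "phase \<theta> 0 = 1" "phase \<theta> (0, 0) = 1" "phase \<theta> b \<noteq> 0"
  "phase (0, 0) b = 1"
  by (simp_all add: phase_def flip: zero_prod_def)

lemma phase_uminus: "phase \<theta> (- b) = inverse (phase \<theta> b)"
proof -
  have "phase \<theta> (- b) * phase \<theta> b = 1" using phase_add[of \<theta> "- b" b] by simp
  then show ?thesis by (metis inverse_unique mult.commute)
qed

definition bloch :: "real \<times> real \<Rightarrow> (site \<Rightarrow> complex) \<Rightarrow> vertex \<Rightarrow> complex" where
  "bloch \<theta> a v = a (fst v) * phase \<theta> (snd v)"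

lemma bloch_in_fibre: "bloch \<theta> a \<in> fibre \<theta>"
  unfolding fibre_def phase_def[symmetric]
  by (intro CollectI allI) (simp only: bloch_def translate_def fst_conv snd_conv phase_add mult_ac)

text \<open>The phase of the cell factors out, so the eigenvalue equation reduces to six scalar
  equations on one cell.\<close>

lemma hop_bloch:
  assumes "\<And>j. l * a j = p * ((a j + a (rot_site j) + a (rot_site (rot_site j))) / 3)
    + q * (a (flip_site j) * phase \<theta> (flip_shift j))"
  shows "hop p q (bloch \<theta> a) v = l * bloch \<theta> a v"
proof -
  have "hop p q (bloch \<theta> a) v =
      (p * ((a (fst v) + a (rot_site (fst v)) + a (rot_site (rot_site (fst v)))) / 3)
        + q * (a (flip_site (fst v)) * phase \<theta> (flip_shift (fst v)))) * phase \<theta> (snd v)"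
    by (simp add: hop_def avg_def bloch_def rot_def flip_def phase_add algebra_simps add_divide_distrib)
  also have "\<dots> = l * bloch \<theta> a v"
    unfolding assms[symmetric] by (simp add: bloch_def)
  finally show ?thesis .
qed

text \<open>A Bloch function with vanishing triangle sums whose values change by the factor \<open>s\<close>
  across the edges between dodecagons solves two linear equations in the three values on a
  triangle; the solution is a cross product.\<close>

lemma flat_band_eigenfunction:
  assumes s: "s * s = (1 :: complex)"
  obtains a where "a V4 \<noteq> 0 \<or> a V5 \<noteq> 0" "\<And>p q v. hop p q (bloch \<theta> a) v = q * s * bloch \<theta> a v"
proof -
  define x where "x = phase \<theta> (1, 0)"
  define y where "y = phase \<theta> (0, 1)"
  \<comment> \<open>The cross product of \<open>(1, 1, 1)\<close> and \<open>(1, y, x)\<close>. It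
    vanishes only for \<open>x = y = 1\<close>; then the two equations coincide and
    \<open>(1, -1, 0)\<close> solves them.\<close>
  define d where "d = (if x = 1 \<and> y = 1 then (1, -1, 0) else (x - y, 1 - x, y - 1))"
  obtain a4 a5 a6 where d': "d = (a4, a5, a6)" by (cases d)
  have sum: "a4 + a5 + a6 = 0" "a4 + x * a6 + y * a5 = 0" and nz: "a4 \<noteq> 0 \<or> a5 \<noteq> 0"
    using d' unfolding d_def by (cases "x = 1 \<and> y = 1"; auto simp: ring_distribs)+
  have inv: "phase \<theta> (-1, 0) = inverse x" "phase \<theta> (0, -1) = inverse y"
    using phase_uminus[of \<theta> "(1, 0)"] phase_uminus[of \<theta> "(0, 1)"] by (simp_all add: x_def y_def)
  have xy: "x \<noteq> 0" "y \<noteq> 0" by (simp_all add: x_def y_def)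
  \<comment> \<open>The values at \<open>V1\<close>, \<open>V2\<close>, \<open>V3\<close> are forced
    by the factor \<open>s\<close> across the edges; the second equation for \<open>a4\<close>,
    \<open>a5\<close>, \<open>a6\<close> then makes their sum vanish.\<close>
  define a where "a j = (case j of V1 \<Rightarrow> s * y * a5 | V2 \<Rightarrow> s * x * a6 | V3 \<Rightarrow> s * a4
    | V4 \<Rightarrow> a4 | V5 \<Rightarrow> a5 | V6 \<Rightarrow> a6)" for j
  have sum': "s * y * a5 + s * x * a6 + s * a4 = 0"
    using arg_cong[OF sum(2), of "\<lambda>t. s * t"] by (simp add: algebra_simps)
  have avg0: "a j + a (rot_site j) + a (rot_site (rot_site j)) = 0" for j
    using sum(1) sum' by (cases j) (simp_all add: a_def add_ac)
  have flp: "a (flip_site j) * phase \<theta> (flip_shift j) = s * a j" for j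
    using xy s by (cases j) (simp_all add: a_def inv field_simps flip: x_def y_def)
  have "hop p q (bloch \<theta> a) v = q * s * bloch \<theta> a v" for p q v
    by (rule hop_bloch) (simp add: avg0 flp)
  moreover have "a V4 \<noteq> 0 \<or> a V5 \<noteq> 0" using nz by (simp add: a_def)
  ultimately show thesis using that by blast
qed

text \<open>For quasi-momentum \<open>(t, -t)\<close> the function \<open>g\<close> with value \<open>s\<close> on one kind of triangle and
  \<open>1\<close> on the other satisfies \<open>avg (g \<circ> flip) = h g\<close>, so \<open>l g + q (g \<circ> flip)\<close> is an eigenfunction
  as soon as \<open>l\<close> solves the quadratic equation. It degenerates only for \<open>l = - s q\<close>, where a
  flat-band function takes over.\<close>

lemma band_eigenfunction:
  fixes h :: real and l p q :: complex
  assumes h: "\<bar>h\<bar> \<le> 1" and l: "l\<^sup>2 - p * l - q\<^sup>2 = p * q * h"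
  obtains \<theta> a j where "a j \<noteq> 0" "\<And>v. hop p q (bloch \<theta> a) v = l * bloch \<theta> a v"
proof -
  \<comment> \<open>\<open>1 + 2 * cos t\<close> cannot reach \<open>3 * h\<close> for
    \<open>h < -1/3\<close>; the sign \<open>s\<close> reduces everything to
    \<open>\<bar>h\<bar>\<close>.\<close>
  define s :: complex where "s = (if h \<ge> 0 then 1 else -1)"
  have s: "s * s = 1" by (simp add: s_def)
  \<comment> \<open>Chosen such that
    \<open>1 + x + y = 1 + 2 * cos t = 3 * \<bar>h\<bar>\<close>.\<close>
  define t where "t = arccos ((3 * \<bar>h\<bar> - 1) / 2)"
  have ct: "cos t = (3 * \<bar>h\<bar> - 1) / 2"
    unfolding t_def using h by (intro cos_arccos) auto
  define x where "x = phase (t, - t) (1, 0)"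
  define y where "y = phase (t, - t) (0, 1)"
  have x: "x = cis t" and y: "y = cis (- t)"
    by (simp_all add: x_def y_def phase_def cis_conv_exp)
  have xy: "x * y = 1" by (simp add: x y cis_mult)
  have inv: "phase (t, - t) (-1, 0) = y" "phase (t, - t) (0, -1) = x"
    by (simp_all add: x y phase_def cis_conv_exp)
  have xyh: "1 + x + y = 3 * \<bar>h\<bar>"
    using ct by (simp add: x y complex_eq_iff)
  have sh: "s * \<bar>h\<bar> = h" by (simp add: s_def)
  show thesis
  proof (cases "l = - s * q")
    case True
    \<comment> \<open>The flat-band function with sign \<open>- s\<close> has eigenvalue
      \<open>- s * q = l\<close> at every quasi-momentum; zero is taken.\<close>
    from s have "(- s) * (- s) = 1" by simp
    then obtain a where "a V4 \<noteq> 0 \<or> a V5 \<noteq> 0"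
      "\<And>v. hop p q (bloch (0, 0) a) v = q * (- s) * bloch (0, 0) a v"
      using flat_band_eigenfunction by metis
    then show thesis using that True by (metis mult.commute mult_minus_left mult_minus_right)
  next
    case False
    \<comment> \<open>This is \<open>l g + q (g \<circ> flip)\<close>, with \<open>x\<close> and
      \<open>y\<close> as the phases picked up by \<open>flip\<close>. Its value at
      \<open>V4\<close> is \<open>l + q * s\<close>, nonzero in this case.\<close>
    define a where "a j = (case j of V1 \<Rightarrow> l * s + q * y | V2 \<Rightarrow> l * s + q * x | V3 \<Rightarrow> l * s + q
      | V4 \<Rightarrow> l + q * s | V5 \<Rightarrow> l + q * s * x | V6 \<Rightarrow> l + q * s * y)" for j
    have ll: "l * l = p * l + p * q * h + q * q"
      using l by (simp add: power2_eq_square algebra_simps)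
    have "l * a j = p * ((a j + a (rot_site j) + a (rot_site (rot_site j))) / 3)
      + q * (a (flip_site j) * phase (t, - t) (flip_shift j))" for j
    proof -
      define H where "H = complex_of_real \<bar>h\<bar>"
      have H: "1 + x + y = 3 * H" "s * H = h" using xyh sh by (simp_all add: H_def)
      have down: "(l * s + q * y + (l * s + q * x) + (l * s + q)) / 3 = l * s + q * H"
        and up: "(l + q * s + (l + q * s * x) + (l + q * s * y)) / 3 = l + q * s * H"
        using H(1) by algebra+
      have "(a j + a (rot_site j) + a (rot_site (rot_site j))) / 3 =
          (if j \<in> {V1, V2, V3} then l * s + q * H else l + q * s * H)"
        unfolding down[symmetric] up[symmetric] by (cases j) (simp_all add: a_def add_ac)
      moreover have "l * (l * s + q * y) = p * (l * s + q * H) + q * ((l + q * s * x) * y)"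
        "l * (l * s + q * x) = p * (l * s + q * H) + q * ((l + q * s * y) * x)"
        "l * (l * s + q) = p * (l * s + q * H) + q * (l + q * s)"
        "l * (l + q * s) = p * (l + q * s * H) + q * (l * s + q)"
        "l * (l + q * s * x) = p * (l + q * s * H) + q * ((l * s + q * y) * x)"
        "l * (l + q * s * y) = p * (l + q * s * H) + q * ((l * s + q * x) * y)"
        using ll xy H(2) s by algebra+
      ultimately show ?thesis
        by (cases j) (simp_all add: a_def inv flip: x_def y_def)
    qed
    then have "hop p q (bloch (t, - t) a) v = l * bloch (t, - t) a v" for v
      by (rule hop_bloch)
    moreover have "a V4 \<noteq> 0"
      using False by (simp add: a_def eq_neg_iff_add_eq_0 mult.commute)
    ultimately show thesis using that by blast
  qed
qed

section \<open>Exponential cutoffs\<close>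

definition cutoff :: "real \<Rightarrow> int \<times> int \<Rightarrow> real" where
  "cutoff r b = r ^ nat \<bar>fst b\<bar> * r ^ nat \<bar>snd b\<bar>"

lemma power_abs_sum_bound:
  fixes r :: real
  assumes r: "0 \<le> r" "r < 1" and "finite A"
  shows "(\<Sum>k\<in>A. r ^ nat \<bar>k\<bar>) \<le> 2 / (1 - r)"
proof -
  have geo: "(\<Sum>n\<in>N. r ^ n) \<le> 1 / (1 - r)" if "finite N" for N :: "nat set"
    using sum_le_suminf[of "\<lambda>n. r ^ n" N] r that by (simp add: suminf_geometric summable_geometric)
  have pos: "(\<Sum>k\<in>B. r ^ nat \<bar>k\<bar>) \<le> 1 / (1 - r)" if "finite B" "inj_on (\<lambda>k. nat \<bar>k\<bar>) B" for B :: "int set"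
    using geo[of "(\<lambda>k. nat \<bar>k\<bar>) ` B"] that by (simp add: sum.reindex)
  have "(\<Sum>k\<in>A. r ^ nat \<bar>k\<bar>) = (\<Sum>k\<in>A \<inter> {0..}. r ^ nat \<bar>k\<bar>) + (\<Sum>k\<in>A - {0..}. r ^ nat \<bar>k\<bar>)"
    by (rule sum.Int_Diff[OF assms(3)])
  also have "\<dots> \<le> 1 / (1 - r) + 1 / (1 - r)"
    using assms(3) by (intro add_mono pos) (auto simp: inj_on_def)
  finally show ?thesis by simp
qed

lemma cutoff_sum_bound:
  assumes r: "0 \<le> r" "r < 1" and "finite B"
  shows "(\<Sum>b\<in>B. cutoff r b) \<le> (2 / (1 - r))\<^sup>2"
proof -
  have "(\<Sum>b\<in>B. cutoff r b) \<le> (\<Sum>b\<in>fst ` B \<times> snd ` B. cutoff r b)"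
    using assms by (intro sum_mono2 subset_fst_snd) (auto simp: cutoff_def)
  also have "\<dots> = (\<Sum>k\<in>fst ` B. r ^ nat \<bar>k\<bar>) * (\<Sum>k\<in>snd ` B. r ^ nat \<bar>k\<bar>)"
    by (simp add: cutoff_def sum_product sum.cartesian_product case_prod_unfold)
  also have "\<dots> \<le> (2 / (1 - r)) * (2 / (1 - r))"
    using assms by (intro mult_mono power_abs_sum_bound sum_nonneg) auto
  finally show ?thesis by (simp add: power2_eq_square)
qed

text \<open>An edge changes one exponent by at most one, and \<open>r = 1 / (1 + \<delta>)\<close>
  gives \<open>r^n - r^(n+1) = \<delta> r^(n+1)\<close> and
  \<open>r^(n-1) - r^n = \<delta> r^n\<close>, both at most \<open>\<delta> r^n\<close>.\<close>

lemma cutoff_shift: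
  assumes "0 < \<delta>" "0 < r" "(1 + \<delta>) * r = 1"
  shows "\<bar>cutoff r b - cutoff r (b + flip_shift j)\<bar> \<le> \<delta> * cutoff r b"
proof -
  have step: "\<bar>r ^ n - r ^ m\<bar> \<le> \<delta> * r ^ n" if mn: "m = Suc n \<or> n = Suc m \<or> m = n" for m n
  proof -
    have up: "r ^ k = r ^ Suc k + \<delta> * r ^ Suc k" for k
    proof -
      have "r ^ k = ((1 + \<delta>) * r) * r ^ k" using assms(3) by simp
      then show ?thesis by (simp add: algebra_simps)
    qed
    have pos: "0 \<le> \<delta> * r ^ k" for k using assms by simp
    have le: "\<delta> * r ^ Suc n \<le> \<delta> * r ^ n"
      using up[of n] pos[of "Suc n"] assms(1) by (intro mult_left_mono) linarith+
    show ?thesis using mn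
    proof (elim disjE)
      assume m: "m = Suc n" then show ?thesis unfolding m using up[of n] pos[of "Suc n"] le by linarith
    next
      assume n: "n = Suc m" then show ?thesis unfolding n using up[of m] pos[of "Suc m"] by linarith
    qed (use pos in simp)
  qed
  obtain i k where b: "b = (i, k)" by (cases b)
  have one: "nat \<bar>i + e\<bar> = Suc (nat \<bar>i\<bar>) \<or> nat \<bar>i\<bar> = Suc (nat \<bar>i + e\<bar>) \<or> nat \<bar>i + e\<bar> = nat \<bar>i\<bar>"
    if "e \<in> {-1, 0, 1}" for i e :: int using that by auto
  have bound: "\<bar>(r ^ nat \<bar>i\<bar> - r ^ nat \<bar>i + e\<bar>) * c\<bar> \<le> \<delta> * (r ^ nat \<bar>i\<bar> * c)"
    if "e \<in> {-1, 0, 1}" "0 \<le> c" for i e c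
    using mult_right_mono[OF step[OF one[OF that(1), of i]] that(2)] that(2)
    by (simp add: abs_mult mult.assoc)
  consider e where "flip_shift j = (e, 0)" "e \<in> {-1, 0, 1}" | e where "flip_shift j = (0, e)" "e \<in> {-1, 0, 1}"
    by (cases j) auto
  then show ?thesis
  proof cases
    case 1
    then have "cutoff r b - cutoff r (b + flip_shift j) = (r ^ nat \<bar>i\<bar> - r ^ nat \<bar>i + e\<bar>) * r ^ nat \<bar>k\<bar>"
      by (simp add: cutoff_def b left_diff_distrib)
    with bound[OF 1(2), of "r ^ nat \<bar>k\<bar>" i] assms(2) show ?thesis
      by (simp add: cutoff_def b)
  next
    case 2
    then have "cutoff r b - cutoff r (b + flip_shift j) = (r ^ nat \<bar>k\<bar> - r ^ nat \<bar>k + e\<bar>) * r ^ nat \<bar>i\<bar>"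
      by (simp add: cutoff_def b algebra_simps)
    with bound[OF 2(2), of "r ^ nat \<bar>i\<bar>" k] assms(2) show ?thesis
      by (simp add: cutoff_def b mult.commute)
  qed
qed

text \<open>The error at a vertex is compared with \<open>F\<close> at the site \<open>j0\<close> of
  the same cell where the modulus of \<open>f\<close> is maximal. The factor \<open>6\<close> counts
  the sites of a cell.\<close>

lemma fibre_cutoff:
  assumes f: "f \<in> fibre \<theta>" and nz: "f v0 \<noteq> 0" and ev: "\<And>v. hop p q f v = l * f v" and \<delta>: "0 < \<delta>"
  obtains F where "F \<in> ell2" "0 < ell2_norm F"
    "ell2_norm (\<lambda>v. l * F v - hop p q F v) \<le> 6 * cmod q * \<delta> * ell2_norm F"
proof -
  define r where "r = 1 / (1 + \<delta>)"
  have r: "0 < r" "r < 1" "(1 + \<delta>) * r = 1" using \<delta> by (auto simp: r_def)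
  have fb: "cmod (f (j, b)) = cmod (f (j, 0))" for j b
  proof -
    have "f (translate b (j, 0)) = phase \<theta> b * f (j, 0)"
      using f unfolding fibre_def phase_def by blast
    then show ?thesis by (simp add: translate_def norm_mult)
  qed
  \<comment> \<open>The modulus of \<open>f\<close> depends only on the site, so a maximum over six
    values bounds it everywhere.\<close>
  define m where "m = Max (range (\<lambda>j. cmod (f (j, 0))))"
  have "m \<in> range (\<lambda>j. cmod (f (j, 0)))" unfolding m_def by (intro Max_in) auto
  then obtain j0 where j0: "m = cmod (f (j0, 0))" by blast
  have fm: "cmod (f v) \<le> m" for v
    using fb[of "fst v" "snd v"] by (simp add: m_def)
  define c where "c v = cutoff r (snd v)" for v :: vertex
  have c0: "0 < c v" for v using r by (simp add: c_def cutoff_def)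
  have c1: "c v \<le> 1" for v using r by (simp add: c_def cutoff_def power_le_one mult_le_one)
  define F where "F v = c v * f v" for v
  have site6: "card (UNIV :: site set) = 6" by (simp add: UNIV_site)
  have cells: "(\<Sum>v\<in>V. k (snd v)) \<le> 6 * (\<Sum>b\<in>snd ` V. k b)"
    if "finite V" "\<And>b. 0 \<le> k b" for V :: "vertex set" and k :: "int \<times> int \<Rightarrow> real"
  proof -
    have "(\<Sum>v\<in>V. k (snd v)) \<le> (\<Sum>v\<in>(UNIV :: site set) \<times> snd ` V. k (snd v))"
    proof (rule sum_mono2)
      show "finite ((UNIV :: site set) \<times> snd ` V)" using that(1) by simp
      show "V \<subseteq> UNIV \<times> snd ` V" by force
    qed (rule that(2))
    also have "\<dots> = 6 * (\<Sum>b\<in>snd ` V. k b)"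
      by (simp add: sum.cartesian_product' site6)
    finally show ?thesis .
  qed
  have F: "F \<in> ell2"
  proof -
    let ?K = "m\<^sup>2 * (6 * (2 / (1 - r))\<^sup>2)"
    have "(\<Sum>v\<in>V. (cmod (F v))\<^sup>2) \<le> ?K" if V: "finite V" for V
    proof -
      have "(cmod (F v))\<^sup>2 \<le> m\<^sup>2 * cutoff r (snd v)" for v
      proof -
        have "(cmod (F v))\<^sup>2 = (c v)\<^sup>2 * (cmod (f v))\<^sup>2"
          by (simp add: F_def norm_mult power_mult_distrib)
        also have "\<dots> \<le> c v * m\<^sup>2"
          using c0[of v] c1[of v] fm[of v]
          by (intro mult_mono power_mono) (auto simp: power2_eq_square mult_left_le)
        finally show ?thesis by (simp add: c_def mult.commute)
      qed
      then have "(\<Sum>v\<in>V. (cmod (F v))\<^sup>2) \<le> m\<^sup>2 * (\<Sum>v\<in>V. cutoff r (snd v))"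
        unfolding sum_distrib_left by (rule sum_mono)
      also have "\<dots> \<le> ?K"
        using cells[OF V, of "cutoff r"] cutoff_sum_bound[of r "snd ` V"] r V
        by (intro mult_left_mono) (auto simp: cutoff_def)
      finally show ?thesis .
    qed
    then show ?thesis unfolding ell2_def
      by (auto intro!: nonneg_bdd_above_summable_on bdd_aboveI2)
  qed
  have err: "cmod (l * F v - hop p q F v) \<le> cmod q * \<delta> * cmod (F (j0, snd v))" for v
  proof -
    \<comment> \<open>The cutoff is constant on triangles, since \<open>rot\<close> stays in the
      cell; only the \<open>flip\<close> term contributes to the error.\<close>
    have "avg F v = c v * avg f v"
      by (simp add: avg_def F_def c_def rot_def algebra_simps add_divide_distrib)
    then have "l * F v - hop p q F v = c v * (l * f v - p * avg f v) - q * (c (flip v) * f (flip v))"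
      by (simp add: hop_def F_def algebra_simps)
    also have "l * f v - p * avg f v = q * f (flip v)"
      using ev[of v] by (simp add: hop_def algebra_simps)
    finally have "l * F v - hop p q F v = q * (complex_of_real (c v - c (flip v)) * f (flip v))"
      by (simp add: algebra_simps)
    then have "cmod (l * F v - hop p q F v) = cmod q * (\<bar>c v - c (flip v)\<bar> * cmod (f (flip v)))"
      by (simp only: norm_mult norm_of_real)
    also have "\<dots> \<le> cmod q * ((\<delta> * c v) * m)"
      using cutoff_shift[OF \<delta> r(1,3), of "snd v" "fst v"] fm[of "flip v"] c0[of v] \<delta>
      by (intro mult_left_mono mult_mono) (auto simp: c_def flip_def r_def)
    also have "\<dots> = cmod q * \<delta> * cmod (F (j0, snd v))"
      using c0[of "(j0, snd v)"] by (simp add: F_def norm_mult fb[of j0 "snd v"] j0 c_def)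
    finally show ?thesis .
  qed
  have "L2_set (\<lambda>v. cmod (l * F v - hop p q F v)) V \<le> 6 * cmod q * \<delta> * ell2_norm F"
    if V: "finite V" for V
  proof -
    have "L2_set (\<lambda>v. cmod (l * F v - hop p q F v)) V
        \<le> L2_set (\<lambda>v. cmod q * \<delta> * cmod (F (j0, snd v))) V"
      by (rule L2_set_mono[OF err]) simp
    also have "\<dots> = cmod q * \<delta> * L2_set (\<lambda>v. cmod (F (j0, snd v))) V"
      using \<delta> by (intro L2_set_right_distrib[symmetric]) simp
    also have "\<dots> \<le> cmod q * \<delta> * (6 * ell2_norm F)"
    proof (rule mult_left_mono)
      have "(\<Sum>v\<in>V. (cmod (F (j0, snd v)))\<^sup>2) \<le> 6 * (\<Sum>b\<in>snd ` V. (cmod (F (j0, b)))\<^sup>2)"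
        by (rule cells[OF V]) simp
      also have "(\<Sum>b\<in>snd ` V. (cmod (F (j0, b)))\<^sup>2) = (\<Sum>v\<in>Pair j0 ` snd ` V. (cmod (F v))\<^sup>2)"
        by (simp add: sum.reindex inj_on_def)
      also have "\<dots> \<le> (ell2_norm F)\<^sup>2"
        unfolding ell2_norm_square using F V by (intro finite_sum_le_infsum) (auto simp: ell2_def)
      \<comment> \<open>A coarse bound that avoids the square root of \<open>6\<close>.\<close>
      also have "6 * (ell2_norm F)\<^sup>2 \<le> (6 * ell2_norm F)\<^sup>2" by (simp add: power_mult_distrib)
      finally show "L2_set (\<lambda>v. cmod (F (j0, snd v))) V \<le> 6 * ell2_norm F"
        unfolding L2_set_def by (intro real_le_lsqrt) (auto intro: sum_nonneg)
    qed (use \<delta> in simp)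
    finally show ?thesis by (simp add: mult_ac)
  qed
  then have "ell2_norm (\<lambda>v. l * F v - hop p q F v) \<le> 6 * cmod q * \<delta> * ell2_norm F"
    by (rule ell2_leI)
  moreover have "0 < cmod (F v0)" using nz c0[of v0] by (simp add: F_def)
  then have "0 < ell2_norm F" using norm_le_ell2_norm[OF F, of v0] by linarith
  ultimately show thesis using F that by blast
qed

subsection \<open>The spectrum\<close>

text \<open>Both bands together are symmetric about \<open>c = 1 - \<alpha> / (2 * \<mu>)\<close>:
  by \<open>2 * \<alpha> + \<beta> = \<mu>\<close> the outer ends are \<open>c - T\<close> and
  \<open>c + T\<close>. Scaling by \<open>\<mu>\<close> turns \<open>c - E\<close> into
  \<open>l - p / 2\<close>.\<close>

lemma band_intervals_iff:
  fixes \<alpha> \<beta> \<mu> E :: real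
  assumes "\<mu> > 0" and "\<alpha> > 0" and "\<beta> > 0" and "2 * \<alpha> + \<beta> = \<mu>"
  shows "E \<in> {0 .. (1 - \<alpha> / (2 * \<mu>)) - \<bar>3 * \<alpha> - 2 * \<beta>\<bar> / (2 * \<mu>)} \<union>
         {(1 - \<alpha> / (2 * \<mu>)) + \<bar>3 * \<alpha> - 2 * \<beta>\<bar> / (2 * \<mu>) .. 2 - \<alpha> / \<mu>} \<longleftrightarrow>
    \<bar>3 * \<alpha> - 2 * \<beta>\<bar> / 2 \<le> \<bar>\<mu> * (1 - E) + \<alpha> - 3 * \<alpha> / 2\<bar> \<and>
    \<bar>\<mu> * (1 - E) + \<alpha> - 3 * \<alpha> / 2\<bar> \<le> (3 * \<alpha> + 2 * \<beta>) / 2"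
    (is "E \<in> ?I \<longleftrightarrow> _")
proof -
  define c where "c = 1 - \<alpha> / (2 * \<mu>)"
  define D where "D = \<bar>3 * \<alpha> - 2 * \<beta>\<bar> / (2 * \<mu>)"
  define T where "T = (3 * \<alpha> + 2 * \<beta>) / (2 * \<mu>)"
  have D: "0 \<le> D" "D \<le> T"
    using assms(1-3) by (auto simp: D_def T_def divide_le_cancel)
  have ends: "0 = c - T" "2 - \<alpha> / \<mu> = c + T"
  proof -
    have e: "3 * \<alpha> + 2 * \<beta> = 2 * \<mu> - \<alpha>" using assms(4) by simp
    have "T = 1 - \<alpha> / (2 * \<mu>)" unfolding T_def e using assms(1) by (simp add: diff_divide_distrib)
    then show "0 = c - T" "2 - \<alpha> / \<mu> = c + T" by (simp_all add: c_def)
  qed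
  have "E \<in> ?I \<longleftrightarrow> E \<in> {c - T..c - D} \<union> {c + D..c + T}"
    by (simp only: D_def[symmetric] c_def[symmetric] ends)
  also have "\<dots> \<longleftrightarrow> D \<le> \<bar>c - E\<bar> \<and> \<bar>c - E\<bar> \<le> T" using D by auto
  also have "\<dots> \<longleftrightarrow> \<mu> * D \<le> \<mu> * \<bar>c - E\<bar> \<and> \<mu> * \<bar>c - E\<bar> \<le> \<mu> * T"
    using assms(1) by simp
  also have "\<mu> * D = \<bar>3 * \<alpha> - 2 * \<beta>\<bar> / 2" using assms(1) by (simp add: D_def)
  also have "\<mu> * T = (3 * \<alpha> + 2 * \<beta>) / 2" using assms(1) by (simp add: T_def)
  also have "\<mu> * \<bar>c - E\<bar> = \<bar>\<mu> * (c - E)\<bar>" using assms(1) by (simp add: abs_mult)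
  also have "\<mu> * (c - E) = (\<mu> * (1 - E) + \<alpha> - 3 * \<alpha> / 2)" using assms(1) by (simp add: c_def field_simps)
  finally show ?thesis .
qed

text \<open>The squares of the two bounds are
  \<open>9 * \<alpha>\<^sup>2 / 4 + \<beta>\<^sup>2\<close> minus and plus
  \<open>3 * \<alpha> * \<beta>\<close>. The right side is \<open>\<bar>w\<bar> \<le> 1\<close>
  after completing the square.\<close>

lemma band_quadratic_iff:
  fixes \<alpha> \<beta> x :: real
  assumes "\<alpha> > 0" and "\<beta> > 0"
  shows "\<bar>3 * \<alpha> - 2 * \<beta>\<bar> / 2 \<le> \<bar>x\<bar> \<and> \<bar>x\<bar> \<le> (3 * \<alpha> + 2 * \<beta>) / 2 \<longleftrightarrow>
      \<bar>x\<^sup>2 - (9 * \<alpha>\<^sup>2 / 4 + \<beta>\<^sup>2)\<bar> \<le> 3 * \<alpha> * \<beta>"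
proof -
  have "\<bar>3 * \<alpha> - 2 * \<beta>\<bar> / 2 \<le> \<bar>x\<bar> \<longleftrightarrow> ((3 * \<alpha> - 2 * \<beta>) / 2)\<^sup>2 \<le> x\<^sup>2"
    using abs_le_square_iff[of "(3 * \<alpha> - 2 * \<beta>) / 2" x] by simp
  moreover have "\<bar>x\<bar> \<le> (3 * \<alpha> + 2 * \<beta>) / 2 \<longleftrightarrow> x\<^sup>2 \<le> ((3 * \<alpha> + 2 * \<beta>) / 2)\<^sup>2"
    using abs_le_square_iff[of x "(3 * \<alpha> + 2 * \<beta>) / 2"] assms by simp
  ultimately show ?thesis
    by (auto simp: power2_eq_square field_simps abs_le_iff)
qed

theorem theorem11:
  fixes \<alpha> \<beta> \<mu> :: real and \<gamma> :: "nat \<Rightarrow> real"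
  assumes "\<mu> > 0" and "\<alpha> > 0" and "\<beta> > 0" and "2 * \<alpha> + \<beta> = \<mu>"
    and "\<forall>k\<in>{1..6}. \<gamma> k = \<alpha>" and "\<forall>k\<in>{7..9}. \<gamma> k = \<beta>"
  shows "op_spectrum ell2 ell2_norm (laplacian \<mu> \<gamma>) =
      complex_of_real `
        ({0 .. (1 - \<alpha> / (2 * \<mu>)) - \<bar>3 * \<alpha> - 2 * \<beta>\<bar> / (2 * \<mu>)} \<union>
         {(1 - \<alpha> / (2 * \<mu>)) + \<bar>3 * \<alpha> - 2 * \<beta>\<bar> / (2 * \<mu>) .. 2 - \<alpha> / \<mu>})
    \<and> flat_band_at \<mu> \<gamma> (3 * \<alpha> / \<mu>)
    \<and> flat_band_at \<mu> \<gamma> (2 - \<alpha> / \<mu>)"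
proof (intro conjI)
  let ?p = "complex_of_real (3 * \<alpha>)" and ?q = "complex_of_real \<beta>"
  have lap: "laplacian \<mu> \<gamma> f v - z * f v =
      complex_of_real (1 / \<mu>) * ((\<mu> * (1 - z) + \<alpha>) * f v - hop ?p ?q f v)"
    for f :: "vertex \<Rightarrow> complex" and v and z :: complex
    using laplacian_minus[OF assms(5,6)] assms(1) by simp
  \<comment> \<open>The flat bands lie at \<open>l = \<beta>\<close> and
    \<open>l = - \<beta>\<close>; solving for \<open>E\<close> with
    \<open>\<beta> = \<mu> - 2 * \<alpha>\<close> gives the two energies.\<close>
  have flat: "flat_band_at \<mu> \<gamma> E" if "s * s = 1" "\<mu> * (1 - E) + \<alpha> = \<beta> * s" for s E :: real
    unfolding flat_band_at_def
  proof
    fix \<theta>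
    have "complex_of_real s * complex_of_real s = 1"
      using that(1) by (metis of_real_1 of_real_mult)
    then obtain a where a: "a V4 \<noteq> 0 \<or> a V5 \<noteq> 0"
      "\<And>v. hop ?p ?q (bloch \<theta> a) v = ?q * of_real s * bloch \<theta> a v"
      using flat_band_eigenfunction by metis
    have l: "\<mu> * (1 - complex_of_real E) + \<alpha> = ?q * of_real s"
      using arg_cong[OF that(2), of complex_of_real] by simp
    have ev: "laplacian \<mu> \<gamma> (bloch \<theta> a) v = complex_of_real E * bloch \<theta> a v" for v
      using lap[of "bloch \<theta> a" v E] unfolding l a(2) by simp
    obtain j where "a j \<noteq> 0" using a(1) by blast
    then have nz: "bloch \<theta> a (j, 0) \<noteq> 0" by (simp add: bloch_def)
    show "complex_of_real E \<in> op_spectrum (fibre \<theta>) fibre_norm (laplacian \<mu> \<gamma>)"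
    proof (rule in_op_spectrumI_kernel[OF bloch_in_fibre])
      show "bloch \<theta> a (j, 0) \<noteq> 0" by (rule nz)
      show "(\<lambda>v. 0) \<in> fibre \<theta>" by (simp add: fibre_def)
    qed (rule ev, simp add: laplacian_def)
  qed
  show "flat_band_at \<mu> \<gamma> (3 * \<alpha> / \<mu>)"
    using assms(1,4) by (intro flat[of 1]) (simp_all add: right_diff_distrib)
  show "flat_band_at \<mu> \<gamma> (2 - \<alpha> / \<mu>)"
    using assms(1,4) by (intro flat[of "-1"]) (simp_all add: right_diff_distrib)
  let ?I = "{0 .. (1 - \<alpha> / (2 * \<mu>)) - \<bar>3 * \<alpha> - 2 * \<beta>\<bar> / (2 * \<mu>)} \<union>
         {(1 - \<alpha> / (2 * \<mu>)) + \<bar>3 * \<alpha> - 2 * \<beta>\<bar> / (2 * \<mu>) .. 2 - \<alpha> / \<mu>}"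
  define m where "m E = \<mu> * (1 - E) + \<alpha> - 3 * \<alpha> / 2" for E :: real
  note I = band_intervals_iff[OF assms(1-4), folded m_def]
  have quad: "l\<^sup>2 - 3 * \<alpha> * l - \<beta>\<^sup>2 = (l - 3 * \<alpha> / 2)\<^sup>2 - (9 * \<alpha>\<^sup>2 / 4 + \<beta>\<^sup>2)" for l :: complex
    by (simp add: power2_eq_square field_simps)
  note band = band_quadratic_iff[OF assms(2,3)]
  show "op_spectrum ell2 ell2_norm (laplacian \<mu> \<gamma>) = complex_of_real ` ?I"
  proof (intro equalityI subsetI)
    fix z assume z: "z \<in> op_spectrum ell2 ell2_norm (laplacian \<mu> \<gamma>)"
    define l where "l = \<mu> * (1 - z) + complex_of_real \<alpha>"
    define w where "w = (l\<^sup>2 - 3 * \<alpha> * l - \<beta>\<^sup>2) / (3 * \<alpha> * \<beta>)"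
    have w: "l\<^sup>2 - 3 * \<alpha> * l - \<beta>\<^sup>2 = 3 * \<alpha> * \<beta> * w"
      using assms by (simp add: w_def)
    have "w \<in> complex_of_real ` {-1..1}"
      using laplacian_resolvent[OF assms(5,6,1,2,3) l_def w] z by (auto simp: op_spectrum_def)
    then obtain h where h: "w = of_real h" "-1 \<le> h" "h \<le> 1" by auto
    define r where "r = 9 * \<alpha>\<^sup>2 / 4 + \<beta>\<^sup>2 + 3 * \<alpha> * \<beta> * h"
    have ab: "0 < \<alpha> * \<beta>" using assms by simp
    have "\<alpha> * \<beta> * (-1) \<le> \<alpha> * \<beta> * h" "\<alpha> * \<beta> * h \<le> \<alpha> * \<beta> * 1"
      using ab h by (intro mult_left_mono; simp)+
    then have hb: "\<bar>3 * \<alpha> * \<beta> * h\<bar> \<le> 3 * \<alpha> * \<beta>" by (simp add: abs_le_iff)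
    \<comment> \<open>This square is the least value of \<open>r\<close>, attained at
      \<open>h = -1\<close>. Hence \<open>l - 3 * \<alpha> / 2\<close> is a real square root, and so
      \<open>z\<close> is real.\<close>
    have "0 \<le> (3 * \<alpha> / 2 - \<beta>)\<^sup>2" by simp
    then have r0: "0 \<le> r" using hb by (simp add: r_def power2_eq_square algebra_simps abs_le_iff)
    have "(l - 3 * \<alpha> / 2)\<^sup>2 = complex_of_real r"
      using w unfolding quad by (simp add: h(1) r_def algebra_simps)
    also have "\<dots> = (complex_of_real (sqrt r))\<^sup>2"
      using r0 by (metis of_real_power real_sqrt_pow2)
    finally have "l - 3 * \<alpha> / 2 = complex_of_real (sqrt r) \<or> l - 3 * \<alpha> / 2 = - complex_of_real (sqrt r)"
      by (simp only: power2_eq_iff)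
    then obtain x where x: "l - 3 * \<alpha> / 2 = complex_of_real x" "x\<^sup>2 = r"
      using r0 by (metis of_real_minus power2_minus real_sqrt_pow2)
    \<comment> \<open>The solution of
      \<open>\<mu> * (1 - E) + \<alpha> = x + 3 * \<alpha> / 2\<close>.\<close>
    define E where "E = 1 - (x + 3 * \<alpha> / 2 - \<alpha>) / \<mu>"
    have mE: "m E = x" using assms(1) by (simp add: m_def E_def)
    have "l = complex_of_real (x + 3 * \<alpha> / 2)" using x(1) by (simp add: algebra_simps)
    moreover have "z = 1 - (l - \<alpha>) / \<mu>" using assms(1) by (simp add: l_def)
    ultimately have "z = complex_of_real E" by (simp add: E_def)
    moreover have "E \<in> ?I"
      unfolding I mE band x(2) using hb by (simp add: r_def)
    ultimately show "z \<in> complex_of_real ` ?I" by blast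
  next
    fix z assume "z \<in> complex_of_real ` ?I"
    then obtain E where z: "z = complex_of_real E" and E: "E \<in> ?I" by blast
    define l where "l = \<mu> * (1 - E) + \<alpha>"
    define h where "h = (l\<^sup>2 - 3 * \<alpha> * l - \<beta>\<^sup>2) / (3 * \<alpha> * \<beta>)"
    have hl: "l\<^sup>2 - 3 * \<alpha> * l - \<beta>\<^sup>2 = 3 * \<alpha> * \<beta> * h" using assms by (simp add: h_def)
    have m: "m E = l - 3 * \<alpha> / 2" by (simp add: m_def l_def)
    have "\<bar>(l - 3 * \<alpha> / 2)\<^sup>2 - (9 * \<alpha>\<^sup>2 / 4 + \<beta>\<^sup>2)\<bar> \<le> 3 * \<alpha> * \<beta>"
      using E unfolding I band m .
    also have "(l - 3 * \<alpha> / 2)\<^sup>2 - (9 * \<alpha>\<^sup>2 / 4 + \<beta>\<^sup>2) = 3 * \<alpha> * \<beta> * h"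
      unfolding hl[symmetric] by (simp add: power2_eq_square field_simps)
    finally have h1: "\<bar>h\<bar> \<le> 1" using assms by (simp add: abs_mult)
    have cl: "(complex_of_real l)\<^sup>2 - ?p * l - ?q\<^sup>2 = ?p * ?q * h"
      using arg_cong[OF hl, of complex_of_real] by simp
    obtain \<theta> a j where a: "a j \<noteq> 0" "\<And>v. hop ?p ?q (bloch \<theta> a) v = l * bloch \<theta> a v"
      using band_eigenfunction[OF h1 cl] by metis
    have nz: "bloch \<theta> a (j, 0) \<noteq> 0" using a(1) by (simp add: bloch_def)
    have lz: "\<mu> * (1 - z) + complex_of_real \<alpha> = l" by (simp add: l_def z)
    show "z \<in> op_spectrum ell2 ell2_norm (laplacian \<mu> \<gamma>)"
    proof (rule in_op_spectrumI_approx)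
      fix \<epsilon> :: real assume \<epsilon>: "\<epsilon> > 0"
      \<comment> \<open>Makes the error factor \<open>6 * \<beta> * \<delta> / \<mu>\<close> equal
        to \<open>\<epsilon>\<close>.\<close>
      define \<delta> where "\<delta> = \<epsilon> * \<mu> / (6 * \<beta>)"
      have \<delta>: "0 < \<delta>" using \<epsilon> assms by (simp add: \<delta>_def)
      obtain F :: "vertex \<Rightarrow> complex" where F: "F \<in> ell2" "0 < ell2_norm F"
        "ell2_norm (\<lambda>v. l * F v - hop ?p ?q F v) \<le> 6 * cmod ?q * \<delta> * ell2_norm F"
        using fibre_cutoff[OF bloch_in_fibre nz a(2) \<delta>] .
      have "(\<lambda>v. complex_of_real l * F v - hop ?p ?q F v) \<in> ell2"
        using F(1) by (intro ell2_diff ell2_scale ell2_hop)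
      then have "ell2_norm (\<lambda>v. laplacian \<mu> \<gamma> F v - z * F v) =
          1 / \<mu> * ell2_norm (\<lambda>v. l * F v - hop ?p ?q F v)"
        unfolding lap lz using assms(1) by (simp only: ell2_scale norm_of_real) simp
      also have "\<dots> \<le> 1 / \<mu> * (6 * cmod ?q * \<delta> * ell2_norm F)"
        using F(3) assms(1) by (intro mult_left_mono) auto
      also have "\<dots> = \<epsilon> * ell2_norm F" using assms by (simp add: \<delta>_def)
      finally show "\<exists>f\<in>ell2. 0 < ell2_norm f \<and>
          ell2_norm (\<lambda>v. laplacian \<mu> \<gamma> f v - z * f v) \<le> \<epsilon> * ell2_norm f"
        using F(1,2) by blast
    qed simp
  qed
qed

end
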